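(* Let $W$ be a group admitting an odd connected Coxeter system of rank $n\ge 2$ whose graph $\mathcal V$ is a tree. Then $W$ is co-Hopfian, i.e. every injective endomorphism of $W$ is an automorphism. In particular, $L_m$ is co-Hopfian for every $m\ge 2$.
   Context: A Coxeter system $(W,S)$ with $S=\{w_1,\dots,w_n\}$ means that $W$ has the presentation $\langle w_1,\dots,w_n \mid (w_iw_j)^{m_{ij}}=1\rangle$, where $m_{ii}=1$ and $m_{ij}=m_{ji}\in\{2,3,4,\dots\}\cup\{\infty\}$ for $i\neq j$ (no relation when $m_{ij}=\infty$). The $m_{ij}$, $i\ne j$, are the exponents and $n$ is the rank. The system is odd if every exponent is odd or $\infty$. The graph $\mathcal V_{(W,S)}$ has vertex set $\{1,\dots,n\}$ and an edge between $i\neq j$ iff $m_{ij}<\infty$; the system is connected if this graph is connected. $L_m=\langle y_1,\dots,y_{m-1}\mid y_j^2=1,\ y_iy_{i+1}y_i=y_{i+1}y_iy_{i+1}\ (1\le i\le m-2)\rangle$. *)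

theory Defs
  imports "HOL-Algebra.Group" "HOL-Library.Extended_Nat"
begin

text \<open>Words over the generators 0..k-1 (letter i stands for the generator w_(i+1)).
  Since all generators in the presentations considered here are involutions
  (this is imposed by relations), positive words suffice. A relation is a pair
  (l, r) of words meaning l = r.\<close>

inductive pres_eq :: "(nat list \<times> nat list) set \<Rightarrow> nat list \<Rightarrow> nat list \<Rightarrow> bool"
  for rels where
  pres_refl: "pres_eq rels u u"
| pres_sym: "pres_eq rels u v \<Longrightarrow> pres_eq rels v u"
| pres_trans: "pres_eq rels u v \<Longrightarrow> pres_eq rels v w \<Longrightarrow> pres_eq rels u w"
| pres_rel: "(l, r) \<in> rels \<Longrightarrow> pres_eq rels (u @ l @ v) (u @ r @ v)"

definition pres_rel_set :: "(nat list \<times> nat list) set \<Rightarrow> (nat list \<times> nat list) set" where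
  "pres_rel_set rels = {(u, v). pres_eq rels u v}"

definition presented_group :: "nat \<Rightarrow> (nat list \<times> nat list) set \<Rightarrow> nat list set monoid" where
  "presented_group k rels =
     \<lparr> carrier = lists {..<k} // pres_rel_set rels,
       mult = (\<lambda>A B. \<Union>a\<in>A. \<Union>b\<in>B. pres_rel_set rels `` {a @ b}),
       one = pres_rel_set rels `` {[]} \<rparr>"

text \<open>Exponents m i j :: enat, with \<infinity> meaning no relation. Indices 0..n-1.\<close>
definition coxeter_matrix :: "nat \<Rightarrow> (nat \<Rightarrow> nat \<Rightarrow> enat) \<Rightarrow> bool" where
  "coxeter_matrix n m \<longleftrightarrow>
     (\<forall>i<n. m i i = 1) \<and>
     (\<forall>i<n. \<forall>j<n. m i j = m j i) \<and>
     (\<forall>i<n. \<forall>j<n. i \<noteq> j \<longrightarrow> m i j \<ge> 2)"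

definition cox_relator :: "nat \<Rightarrow> nat \<Rightarrow> nat \<Rightarrow> nat list" where
  "cox_relator i j k = concat (replicate k [i, j])"

definition coxeter_rels :: "nat \<Rightarrow> (nat \<Rightarrow> nat \<Rightarrow> enat) \<Rightarrow> (nat list \<times> nat list) set" where
  "coxeter_rels n m = {(cox_relator i j k, []) | i j k. i < n \<and> j < n \<and> m i j = enat k}"

definition coxeter_group :: "nat \<Rightarrow> (nat \<Rightarrow> nat \<Rightarrow> enat) \<Rightarrow> nat list set monoid" where
  "coxeter_group n m = presented_group n (coxeter_rels n m)"

definition odd_coxeter :: "nat \<Rightarrow> (nat \<Rightarrow> nat \<Rightarrow> enat) \<Rightarrow> bool" where
  "odd_coxeter n m \<longleftrightarrow>
     (\<forall>i<n. \<forall>j<n. i \<noteq> j \<longrightarrow> m i j = \<infinity> \<or> (\<exists>k. m i j = enat k \<and> odd k))"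

definition cox_adj :: "nat \<Rightarrow> (nat \<Rightarrow> nat \<Rightarrow> enat) \<Rightarrow> nat \<Rightarrow> nat \<Rightarrow> bool" where
  "cox_adj n m i j \<longleftrightarrow> i < n \<and> j < n \<and> i \<noteq> j \<and> m i j < \<infinity>"

definition cox_connected :: "nat \<Rightarrow> (nat \<Rightarrow> nat \<Rightarrow> enat) \<Rightarrow> bool" where
  "cox_connected n m \<longleftrightarrow> (\<forall>i<n. \<forall>j<n. (cox_adj n m)\<^sup>*\<^sup>* i j)"

definition cox_acyclic :: "nat \<Rightarrow> (nat \<Rightarrow> nat \<Rightarrow> enat) \<Rightarrow> bool" where
  "cox_acyclic n m \<longleftrightarrow>
     \<not> (\<exists>vs. length vs \<ge> 3 \<and> distinct vs \<and>
            (\<forall>i. Suc i < length vs \<longrightarrow> cox_adj n m (vs ! i) (vs ! Suc i)) \<and>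
            cox_adj n m (last vs) (hd vs))"

definition cox_tree :: "nat \<Rightarrow> (nat \<Rightarrow> nat \<Rightarrow> enat) \<Rightarrow> bool" where
  "cox_tree n m \<longleftrightarrow> cox_connected n m \<and> cox_acyclic n m"

definition co_hopfian :: "('a, 'b) monoid_scheme \<Rightarrow> bool" where
  "co_hopfian G \<longleftrightarrow> (\<forall>f \<in> hom G G. inj_on f (carrier G) \<longrightarrow> f \<in> iso G G)"

text \<open>Generators y_1..y_(m-1) are letters 0..m-2.\<close>
definition L_rels :: "nat \<Rightarrow> (nat list \<times> nat list) set" where
  "L_rels m = {([i, i], []) | i. i < m - 1} \<union>
              {([i, Suc i, i], [Suc i, i, Suc i]) | i. Suc i < m - 1}"

definition L_group :: "nat \<Rightarrow> nat list set monoid" where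
  "L_group m = presented_group (m - 1) (L_rels m)"

end

theory Submission
  imports Defs "HOL-Algebra.Generated_Groups" "HOL-Algebra.Bij"
begin

text \<open>
  Write \<open>t\<close> for the first generator. Since the graph is a tree with odd labels, all generators are
  conjugate to \<open>t\<close>, and conjugating every dihedral edge group so that it contains \<open>t\<close> presents \<open>W\<close> as
  a semidirect product of a free product of odd cyclic groups \<open>\<langle>x\<^sub>k\<rangle>\<close> (one per edge) with \<open>\<langle>t\<rangle>\<close>,
  where \<open>t\<close> inverts every \<open>x\<^sub>k\<close>. Normal forms in the free product show that every involution of \<open>W\<close>
  is conjugate to \<open>t\<close>, and that the set \<open>S\<close> of torsion elements inverted by \<open>t\<close> is finite: an element
  inverted by \<open>t\<close> is (apart from \<open>t\<close> itself) a palindromic word, and a palindrome of length more than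
  one has infinite order. Given an injective endomorphism, compose it with an inner automorphism so
  that it fixes \<open>t\<close>. It then maps the finite set \<open>S\<close> injectively into itself, hence onto itself, and
  \<open>S\<close> generates \<open>W\<close>.
\<close>

section \<open>A criterion for co-Hopfian groups\<close>

text \<open>\<open>S\<close> is described by group operations, torsion and \<open>t\<close> alone,
  so an endomorphism that fixes \<open>t\<close> maps \<open>S\<close> into itself. For an injective
  one, finiteness of \<open>S\<close> turns this into equality.\<close>

lemma (in group) co_hopfian_if_finite_inverted_torsion:
  assumes t: "t \<in> carrier G" "t \<otimes> t = \<one>" "t \<noteq> \<one>"
    and conj: "\<And>g. g \<in> carrier G \<Longrightarrow> g \<otimes> g = \<one> \<Longrightarrow> g \<noteq> \<one> \<Longrightarrow>
                 \<exists>h \<in> carrier G. g = h \<otimes> t \<otimes> inv h"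
    and S_def: "S = {y \<in> carrier G. t \<otimes> y \<otimes> t = inv y \<and> (\<exists>k > (0::nat). y [^] k = \<one>)}"
    and fin: "finite S" and gen: "generate G S = carrier G"
  shows "co_hopfian G"
  unfolding co_hopfian_def
proof (intro ballI impI)
  fix f assume f: "f \<in> hom G G" and inj: "inj_on f (carrier G)"
  interpret f: group_hom G G f using f by unfold_locales
  have "f t \<noteq> \<one>" using inj t f.hom_one by (metis inj_onD one_closed)
  moreover have "f t \<otimes> f t = \<one>" using t f.hom_mult f.hom_one by metis
  ultimately obtain h where h: "h \<in> carrier G" "f t = h \<otimes> t \<otimes> inv h"
    using conj f.hom_closed t by blast
  \<comment> \<open>The inner automorphism that undoes the conjugation in \<open>f t\<close>, so
    that \<open>c\<close> after \<open>f\<close> fixes \<open>t\<close>.\<close>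
  define c where "c g = inv h \<otimes> g \<otimes> h" for g
  have c_closed: "g \<in> carrier G \<Longrightarrow> c g \<in> carrier G" for g using h by (simp add: c_def)
  have c_conj: "g \<in> carrier G \<Longrightarrow> h \<otimes> c g \<otimes> inv h = g" for g
    using h by (simp add: c_def m_assoc inv_solve_right) (simp add: m_assoc[symmetric])
  have c_hom: "c \<in> hom G G"
    using h by (auto simp: hom_def c_def m_assoc) (simp add: m_assoc[symmetric])
  interpret cf: group_hom G G "c \<circ> f"
    by unfold_locales (rule Group.hom_compose[OF f c_hom])
  let ?g = "c \<circ> f"
  have g_inj: "inj_on ?g (carrier G)"
  proof (rule inj_onI)
    fix a b assume ab: "a \<in> carrier G" "b \<in> carrier G" "?g a = ?g b"
    then have "f a = f b" using c_conj f.hom_closed by (metis comp_apply)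
    then show "a = b" using inj ab by (meson inj_onD)
  qed
  have gt: "?g t = t"
    using h t by (simp add: c_def m_assoc) (simp add: m_assoc[symmetric])
  have "?g y \<in> S" if yS: "y \<in> S" for y
  proof -
    have y: "y \<in> carrier G" "t \<otimes> y \<otimes> t = inv y" using that S_def by auto
    obtain k :: nat where k: "k > 0" "y [^] k = \<one>" using yS S_def by auto
    have "t \<otimes> ?g y \<otimes> t = ?g (t \<otimes> y \<otimes> t)"
      using gt y t by (metis cf.hom_mult m_closed)
    also have "\<dots> = inv (?g y)" using y cf.hom_inv by simp
    finally have 1: "t \<otimes> ?g y \<otimes> t = inv (?g y)" .
    have "?g y [^] k = \<one>" using k y by (metis cf.hom_nat_pow cf.hom_one)
    then show ?thesis using 1 k y cf.hom_closed S_def by blast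
  qed
  then have "?g ` S = S"
    using fin g_inj S_def by (intro endo_inj_surj) (auto intro: inj_on_subset)
  then have "S \<subseteq> ?g ` carrier G" using S_def by blast
  then have "carrier G \<subseteq> ?g ` carrier G"
    using gen cf.img_is_subgroup generate_subgroup_incl by metis
  \<comment> \<open>Surjectivity passes from the composite back to \<open>f\<close>, since
    conjugation by \<open>h\<close> recovers \<open>b\<close> from \<open>c b\<close>.\<close>
  have "carrier G \<subseteq> f ` carrier G"
  proof
    fix b assume b: "b \<in> carrier G"
    then have "c b \<in> ?g ` carrier G" using \<open>carrier G \<subseteq> ?g ` carrier G\<close> c_closed by blast
    then obtain a where a: "a \<in> carrier G" "c b = c (f a)" by auto
    have "b = h \<otimes> c (f a) \<otimes> inv h" using c_conj[OF b] a(2) by simp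
    also have "\<dots> = f a" using c_conj a(1) f.hom_closed by blast
    finally have "b = f a" .
    then show "b \<in> f ` carrier G" using a by blast
  qed
  then show "f \<in> iso G G"
    using f inj by (auto simp: iso_def bij_betw_def)
qed

lemma (in group) conj_nat_pow:
  assumes "g \<in> carrier G" "y \<in> carrier G"
  shows "(inv g \<otimes> y \<otimes> g) [^] (l::nat) = inv g \<otimes> y [^] l \<otimes> g"
proof (induction l)
  case (Suc l)
  have "inv g \<otimes> y [^] l \<otimes> g \<otimes> (inv g \<otimes> y \<otimes> g) = inv g \<otimes> y [^] l \<otimes> (g \<otimes> inv g) \<otimes> y \<otimes> g"
    using assms by (simp only: m_assoc m_closed nat_pow_closed inv_closed)
  then show ?case using Suc assms by (simp add: m_assoc)
qed (use assms in simp)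

section \<open>Reduced words in free products of cyclic groups\<close>

text \<open>The two halves of \<open>w\<close> determine each other, and a middle letter is compared
  with itself. A general \<open>f\<close> serves both palindromes (\<open>f = id\<close>) and words
  equal to their formal inverse (\<open>f = inv_syl M\<close>).\<close>

lemma fixed_by_rev_map_cases:
  assumes "w = rev (map f w)"
  shows "(\<exists>q. w = q @ rev (map f q)) \<or> (\<exists>q a. f a = a \<and> w = q @ [a] @ rev (map f q))"
proof -
  let ?n = "length w div 2"
  \<comment> \<open>For odd length the piece taken on the right is one longer than \<open>?n\<close>
    and contains the middle letter.\<close>
  have d: "drop ?n w = rev (map f (take (length w - ?n) w))"
    using assms by (metis drop_rev length_map length_rev take_map)
  show ?thesis
  proof (cases "even (length w)")
    case True
    then have "length w - ?n = ?n" by auto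
    then show ?thesis using d by (metis append_take_drop_id)
  next
    case False
    then have l: "length w - ?n = Suc ?n" "?n < length w" by (auto elim!: oddE)
    then have tk: "take (length w - ?n) w = take ?n w @ [w ! ?n]"
      by (simp add: take_Suc_conv_app_nth)
    have "w ! ?n = rev (map f w) ! ?n" using assms by simp
    also have "\<dots> = f (w ! ?n)"
    proof -
      have "length w - Suc ?n = ?n" using l by linarith
      then show ?thesis using l by (simp add: rev_nth)
    qed
    finally have "f (w ! ?n) = w ! ?n" by simp
    moreover have "w = take ?n w @ [w ! ?n] @ rev (map f (take ?n w))"
    proof -
      have "drop ?n w = [w ! ?n] @ rev (map f (take ?n w))"
        using d tk \<open>f (w ! ?n) = w ! ?n\<close> by simp
      then show ?thesis by (metis append_take_drop_id)
    qed
    ultimately show ?thesis by blast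
  qed
qed

text \<open>Normal forms in the free product of cyclic groups of orders \<open>M k\<close>,
  \<open>k\<close> in \<open>K\<close>. A pair \<open>(k, l)\<close> stands for the
  \<open>l\<close>-th power of the generator of factor \<open>k\<close>.\<close>

definition reduced :: "'k set \<Rightarrow> ('k \<Rightarrow> nat) \<Rightarrow> ('k \<times> nat) list \<Rightarrow> bool" where
  "reduced K M w \<longleftrightarrow>
     (\<forall>s \<in> set w. fst s \<in> K \<and> 0 < snd s \<and> snd s < M (fst s)) \<and> distinct_adj (map fst w)"

text \<open>Mapped over a word without reversal, this is the effect of conjugation by
  \<open>t\<close>; together with reversal it gives the inverse.\<close>

definition inv_syl :: "('k \<Rightarrow> nat) \<Rightarrow> 'k \<times> nat \<Rightarrow> 'k \<times> nat" where
  "inv_syl M s = (fst s, M (fst s) - snd s)"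

lemma fst_inv_syl [simp]: "fst (inv_syl M s) = fst s"
  by (simp add: inv_syl_def)

lemma reduced_Nil [simp]: "reduced K M []"
  by (simp add: reduced_def)

lemma reduced_rev [simp]: "reduced K M (rev w) = reduced K M w"
  by (simp add: reduced_def rev_map[symmetric])

lemma reduced_map_inv_syl: "reduced K M w \<Longrightarrow> reduced K M (map (inv_syl M) w)"
  by (auto simp: reduced_def inv_syl_def comp_def)

lemma inv_syl_inv_syl: "reduced K M w \<Longrightarrow> map (inv_syl M) (map (inv_syl M) w) = w"
  by (auto simp: reduced_def inv_syl_def intro!: map_idI)

lemma reduced_Cons:
  "reduced K M (s # w) \<longleftrightarrow> fst s \<in> K \<and> 0 < snd s \<and> snd s < M (fst s) \<and> reduced K M w \<and>
     (w = [] \<or> fst (hd w) \<noteq> fst s)"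
  by (cases w) (auto simp: reduced_def)

lemma reduced_append:
  "reduced K M (u @ v) \<longleftrightarrow> reduced K M u \<and> reduced K M v \<and>
     (u = [] \<or> v = [] \<or> fst (last u) \<noteq> fst (hd v))"
  by (auto simp: reduced_def distinct_adj_append_iff last_map hd_map)

text \<open>Powers of a cyclically reduced word involve no cancellation; this is how infinite order
  is detected later.\<close>

lemma reduced_concat_replicate:
  assumes "reduced K M w" "w = [] \<or> fst (last w) \<noteq> fst (hd w)"
  shows "reduced K M (concat (replicate k w))"
proof (cases "w = []")
  case False
  \<comment> \<open>The induction also tracks the first syllable, because the next copy of
    \<open>w\<close> has to fit in front of it.\<close>
  have "reduced K M (concat (replicate k w)) \<and> (k > 0 \<longrightarrow> hd (concat (replicate k w)) = hd w)"
    using assms False by (induction k) (auto simp: reduced_append)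
  then show ?thesis by blast
qed simp

text \<open>The word is cut in the middle: the two middle syllables of an even word would belong to
  the same factor.\<close>
lemma reduced_palindrome_cases [consumes 2]:
  assumes w: "reduced K M w" "w = rev w"
  obtains "w = []" | q k l where "w = q @ [(k, l)] @ rev q"
proof -
  have "q = []" if "w = q @ rev q" for q
    using w(1) that by (cases q rule: rev_cases) (auto simp: reduced_append reduced_Cons)
  moreover have "w = rev (map id w)" using w(2) by (simp only: list.map_id0 id_apply)
  then have "(\<exists>q. w = q @ rev q) \<or> (\<exists>q a. w = q @ [a] @ rev q)"
    using fixed_by_rev_map_cases[of w id] unfolding list.map_id0 id_apply by blast
  ultimately show ?thesis using that by (metis append_Nil rev.simps(1) surj_pair)
qed

text \<open>An even word would have two neighbouring middle syllables from one factor; an odd one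
  would have a middle exponent equal to half of an odd order. Hence the free product contains no
  involution.\<close>

lemma reduced_self_inverse:
  assumes w: "reduced K M w" "w = rev (map (inv_syl M) w)" and odd: "\<And>k. k \<in> K \<Longrightarrow> odd (M k)"
  shows "w = []"
proof -
  have "q = []" if "w = q @ rev (map (inv_syl M) q)" for q
    using w(1) that by (cases q rule: rev_cases) (auto simp: reduced_append reduced_Cons)
  moreover have "inv_syl M a \<noteq> a" if "w = q @ [a] @ rev (map (inv_syl M) q)" for q a
  proof
    assume "inv_syl M a = a"
    then have "M (fst a) = 2 * snd a" using w(1) that
      by (cases a) (auto simp: reduced_append reduced_Cons inv_syl_def)
    moreover have "odd (M (fst a))" using odd w(1) that by (auto simp: reduced_append reduced_Cons)
    ultimately show False by simp
  qed
  ultimately show ?thesis using fixed_by_rev_map_cases[OF w(2)] by (metis append_Nil list.map(1) rev.simps(1))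
qed

section \<open>Involutions and inverted torsion in the semidirect product\<close>

primrec syl_prod :: "('a, 'b) monoid_scheme \<Rightarrow> ('k \<Rightarrow> 'a) \<Rightarrow> ('k \<times> nat) list \<Rightarrow> 'a" where
  "syl_prod G x [] = \<one>\<^bsub>G\<^esub>"
| "syl_prod G x (s # w) = x (fst s) [^]\<^bsub>G\<^esub> snd s \<otimes>\<^bsub>G\<^esub> syl_prod G x w"

text \<open>An internal description of the semidirect product: the last two assumptions say that
  normal forms \<open>ev w\<close> and \<open>ev w\<close> times \<open>t\<close> are unique. No
  presentation enters the arguments made here.\<close>

locale inverted_free_product = group G for G (structure) +
  fixes t :: 'a and x :: "'k \<Rightarrow> 'a" and K :: "'k set" and M :: "'k \<Rightarrow> nat"
  assumes finite_K: "finite K"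
    and odd_M: "k \<in> K \<Longrightarrow> odd (M k)"
    and t_closed [simp]: "t \<in> carrier G"
    and t_sq: "t \<otimes> t = \<one>"
    and x_closed: "k \<in> K \<Longrightarrow> x k \<in> carrier G"
    and x_pow: "k \<in> K \<Longrightarrow> x k [^] M k = \<one>"
    and t_x_t: "k \<in> K \<Longrightarrow> t \<otimes> x k \<otimes> t = inv x k"
    and generated: "generate G (insert t (x ` K)) = carrier G"
    and syl_prod_inj:
      "reduced K M w \<Longrightarrow> reduced K M w' \<Longrightarrow> syl_prod G x w = syl_prod G x w' \<Longrightarrow> w = w'"
    and syl_prod_neq_t:
      "reduced K M w \<Longrightarrow> reduced K M w' \<Longrightarrow> syl_prod G x w \<noteq> syl_prod G x w' \<otimes> t"
begin

abbreviation "ev \<equiv> syl_prod G x"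

lemma ev_closed: "fst ` set w \<subseteq> K \<Longrightarrow> ev w \<in> carrier G"
  by (induction w) (auto simp: x_closed)

lemma reduced_fst: "reduced K M w \<Longrightarrow> fst ` set w \<subseteq> K"
  by (auto simp: reduced_def)

lemma ev_closed' [simp]: "reduced K M w \<Longrightarrow> ev w \<in> carrier G"
  by (simp add: ev_closed reduced_fst)

lemma ev_append:
  "fst ` set u \<subseteq> K \<Longrightarrow> fst ` set v \<subseteq> K \<Longrightarrow> ev (u @ v) = ev u \<otimes> ev v"
  by (induction u) (auto simp: ev_closed x_closed m_assoc)

lemma inv_t [simp]: "inv t = t"
  using inv_equality[OF t_sq] by simp

lemma t_t_cancel [simp]: "g \<in> carrier G \<Longrightarrow> t \<otimes> (t \<otimes> g) = g"
  by (simp add: m_assoc[symmetric] t_sq)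

lemma x_pow_mod: "k \<in> K \<Longrightarrow> x k [^] (l mod M k) = x k [^] l"
proof -
  assume k: "k \<in> K"
  have "x k [^] l = x k [^] (M k * (l div M k) + l mod M k)" by simp
  also have "\<dots> = (x k [^] M k) [^] (l div M k) \<otimes> x k [^] (l mod M k)"
    using k by (simp only: nat_pow_mult[symmetric] nat_pow_pow x_closed)
  finally show ?thesis using k by (simp add: x_pow x_closed)
qed

lemma inv_x_pow: "k \<in> K \<Longrightarrow> l \<le> M k \<Longrightarrow> inv (x k [^] l) = x k [^] (M k - l)"
  by (rule inv_equality) (simp_all add: nat_pow_mult x_closed x_pow)

lemma t_pow_t: "g \<in> carrier G \<Longrightarrow> t \<otimes> g [^] (l::nat) \<otimes> t = (t \<otimes> g \<otimes> t) [^] l"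
  using conj_nat_pow[of t g l] by simp

lemma inv_ev: "reduced K M w \<Longrightarrow> inv (ev w) = ev (rev (map (inv_syl M) w))"
proof (induction w)
  case (Cons s w)
  then have s: "fst s \<in> K" "snd s \<le> M (fst s)" and w: "reduced K M w"
    by (auto simp: reduced_Cons)
  have w': "fst ` set (rev (map (inv_syl M) w)) \<subseteq> K"
    using reduced_fst[OF w] by auto
  have "inv (ev (s # w)) = inv (ev w) \<otimes> inv (x (fst s) [^] snd s)"
    using s w by (simp add: inv_mult_group x_closed)
  also have "\<dots> = ev (rev (map (inv_syl M) w)) \<otimes> ev [inv_syl M s]"
    using Cons.IH w s by (simp add: inv_x_pow x_closed inv_syl_def[of M s])
  also have "\<dots> = ev (rev (map (inv_syl M) w) @ [inv_syl M s])"
    using w' s by (subst ev_append) auto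
  finally show ?case by simp
qed simp

lemma t_ev_t: "reduced K M w \<Longrightarrow> t \<otimes> ev w \<otimes> t = ev (map (inv_syl M) w)"
proof (induction w)
  case (Cons s w)
  then have s: "fst s \<in> K" "snd s \<le> M (fst s)" and w: "reduced K M w"
    by (auto simp: reduced_Cons)
  have "t \<otimes> ev (s # w) \<otimes> t = (t \<otimes> x (fst s) [^] snd s \<otimes> t) \<otimes> (t \<otimes> ev w \<otimes> t)"
    using s w by (simp add: x_closed m_assoc)
  also have "t \<otimes> x (fst s) [^] snd s \<otimes> t = x (fst s) [^] (M (fst s) - snd s)"
    using s by (simp add: t_pow_t t_x_t x_closed nat_pow_inv inv_x_pow)
  finally show ?case using Cons.IH w by (simp add: inv_syl_def[of M s])
qed (simp add: t_sq)

lemma t_ev: "reduced K M w \<Longrightarrow> t \<otimes> ev w = ev (map (inv_syl M) w) \<otimes> t"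
  using t_ev_t[of w] by (metis ev_closed' inv_solve_right inv_t m_closed t_closed)

text \<open>A power of \<open>x k\<close> either merges with a leading syllable of its own factor or
  becomes a new one, and disappears when the exponent is 0 modulo \<open>M k\<close>.\<close>

lemma ex_reduced_Cons:
  fixes l :: nat
  assumes "reduced K M w" "k \<in> K"
  shows "\<exists>w'. reduced K M w' \<and> ev w' = x k [^] l \<otimes> ev w"
proof -
  \<comment> \<open>First the words that do not start in factor \<open>k\<close>; the general case
    splits off the leading syllable and adds the exponents.\<close>
  have *: "\<exists>w'. reduced K M w' \<and> ev w' = x k [^] l \<otimes> ev w"
    if "reduced K M w" "w = [] \<or> fst (hd w) \<noteq> k" for l :: nat and w
  proof (cases "l mod M k = 0")
    case True
    then have "x k [^] l = \<one>" using x_pow_mod[OF assms(2), of l] by simp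
    then show ?thesis using that by auto
  next
    case False
    moreover have "M k > 0" using odd_M[OF assms(2)] by (rule odd_pos)
    ultimately have "reduced K M ((k, l mod M k) # w)"
      using that assms by (auto simp: reduced_Cons)
    moreover have "ev ((k, l mod M k) # w) = x k [^] l \<otimes> ev w"
      using assms(2) by (simp add: x_pow_mod)
    ultimately show ?thesis by blast
  qed
  show ?thesis
  proof (cases "w = [] \<or> fst (hd w) \<noteq> k")
    case False
    then obtain j v where v: "w = (k, j) # v" by (cases w) auto
    then have "x k [^] l \<otimes> ev w = x k [^] (l + j) \<otimes> ev v" "reduced K M v"
        "v = [] \<or> fst (hd v) \<noteq> k"
      using assms by (auto simp: reduced_Cons x_closed m_assoc[symmetric] nat_pow_mult)
    then show ?thesis using * by metis
  qed (use * assms in blast)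
qed

lemma ex_reduced: "fst ` set u \<subseteq> K \<Longrightarrow> \<exists>w. reduced K M w \<and> ev w = ev u"
proof (induction u)
  case Nil
  show ?case using reduced_Nil by blast
next
  case (Cons s u)
  then obtain w where "reduced K M w" "ev w = ev u" by auto
  then show ?case using ex_reduced_Cons[of w "fst s" "snd s"] Cons.prems by auto
qed

lemma reduced_mult:
  assumes "reduced K M u" "reduced K M v"
  shows "\<exists>w. reduced K M w \<and> ev w = ev u \<otimes> ev v"
  using ex_reduced[of "u @ v"] assms reduced_fst[of u] reduced_fst[of v]
  by (auto simp: ev_append image_Un)

text \<open>The elements of these two shapes are closed under products, since \<open>t\<close> moves
  to the right past \<open>ev w\<close> at the cost of inverting each syllable.\<close>

lemma normal_form_cases:
  assumes "g \<in> carrier G"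
  obtains w where "reduced K M w" "g = ev w" | w where "reduced K M w" "g = ev w \<otimes> t"
proof -
  have "g \<in> generate G (insert t (x ` K))" using assms generated by simp
  then have "\<exists>w. reduced K M w \<and> (g = ev w \<or> g = ev w \<otimes> t)"
  proof (induction rule: generate.induct)
    case one
    show ?case by (rule exI[of _ "[]"]) simp
  next
    case (incl h)
    show ?case
    proof (cases "h = t")
      case True
      then show ?thesis by (intro exI[of _ "[]"]) simp
    next
      case False
      then obtain k where "k \<in> K" "h = x k" using incl by auto
      then show ?thesis using ex_reduced[of "[(k, 1)]"] by (auto simp: x_closed)
    qed
  next
    case (inv h)
    show ?case
    proof (cases "h = t")
      case True
      then show ?thesis by (intro exI[of _ "[]"]) simp
    next
      case False
      then obtain k where k: "k \<in> K" "h = x k" using inv by auto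
      \<comment> \<open>The inverse of \<open>x k\<close> is its power with exponent
        \<open>M k - 1\<close>.\<close>
      then have "M k \<ge> 1" using odd_M odd_pos by (metis One_nat_def Suc_leI)
      then show ?thesis using ex_reduced[of "[(k, M k - 1)]"] k inv_x_pow[of k 1]
        by (auto simp: x_closed)
    qed
  next
    case (eng g h)
    then obtain u v where u: "reduced K M u" "g = ev u \<or> g = ev u \<otimes> t"
      and v: "reduced K M v" "h = ev v \<or> h = ev v \<otimes> t" by auto
    obtain w where w: "reduced K M w" "ev w = ev u \<otimes> ev v" using reduced_mult u v by blast
    \<comment> \<open>Needed when the left factor ends in \<open>t\<close>, which has to pass
      \<open>v\<close>.\<close>
    obtain w' where w': "reduced K M w'" "ev w' = ev u \<otimes> ev (map (inv_syl M) v)"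
      using reduced_mult u v reduced_map_inv_syl by blast
    show ?case
    proof (cases "g = ev u")
      case True
      then show ?thesis using u v w by (metis ev_closed' m_assoc t_closed)
    next
      case False
      then have "g \<otimes> h = ev w' \<or> g \<otimes> h = ev w' \<otimes> t"
        using u v w' reduced_map_inv_syl[OF v(1)]
        by (auto simp: m_assoc t_ev t_sq) (simp add: m_assoc[symmetric] t_ev_t)
      then show ?thesis using w' by blast
    qed
  qed
  then show ?thesis using that by blast
qed

lemma t_neq_one: "t \<noteq> \<one>"
  using syl_prod_neq_t[of "[]" "[]"] by simp

lemma self_inverse_ev:
  assumes "reduced K M w" "inv (ev w) = ev w"
  shows "w = []"
  using assms inv_ev[of w] syl_prod_inj[of w "rev (map (inv_syl M) w)"]
  by (intro reduced_self_inverse[of K M w]) (auto simp: reduced_map_inv_syl odd_M)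

text \<open>Inversion reverses the word and inverts its syllables, conjugation by \<open>t\<close>
  only inverts them; together only the reversal remains. This is where palindromes come
  from.\<close>

lemma inv_ev_inv_syl: "reduced K M w \<Longrightarrow> inv (ev (map (inv_syl M) w)) = ev (rev w)"
  by (simp only: inv_ev reduced_map_inv_syl inv_syl_inv_syl)

text \<open>A syllable is a square because its factor has odd order, so a palindrome
  \<open>q x\<^sup>l rev q\<close> equals \<open>c t c\<inverse> t\<close> with \<open>c = q x\<^sup>h\<close> where \<open>2 h = l\<close> modulo the order.\<close>
lemma involution_conjugate:
  assumes g: "g \<in> carrier G" "g \<otimes> g = \<one>" "g \<noteq> \<one>"
  shows "\<exists>h \<in> carrier G. g = h \<otimes> t \<otimes> inv h"
  using g(1)
proof (cases rule: normal_form_cases)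
  case (1 w)
  then have "inv (ev w) = ev w" using g inv_equality by blast
  then show ?thesis using self_inverse_ev 1 g by fastforce
next
  case (2 w)
  \<comment> \<open>The square of \<open>ev w\<close> times \<open>t\<close> is trivial exactly when
    \<open>ev w\<close> is the inverse of its conjugate by \<open>t\<close>, which makes
    \<open>w\<close> a palindrome.\<close>
  have "ev w \<otimes> (t \<otimes> ev w \<otimes> t) = \<one>" using 2 g by (simp add: m_assoc)
  then have "ev w = inv (t \<otimes> ev w \<otimes> t)"
    using 2 by (intro inv_equality[symmetric]) auto
  also have "\<dots> = ev (rev w)" using 2 by (simp only: t_ev_t inv_ev_inv_syl)
  finally have "w = rev w" using 2 syl_prod_inj by simp
  from 2(1) this show ?thesis
  proof (cases rule: reduced_palindrome_cases)
    case 1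
    then show ?thesis using \<open>g = ev w \<otimes> t\<close> by (intro bexI[of _ \<one>]) auto
  next
    case (2 q k l)
    note w = \<open>reduced K M w\<close>[unfolded 2]
    have q: "reduced K M q" and k: "k \<in> K" using w by (auto simp: reduced_append reduced_Cons)
    \<comment> \<open>Half of \<open>l\<close> modulo the odd number \<open>M k\<close>.\<close>
    define h where "h = l * ((M k + 1) div 2)"
    obtain i where "M k = 2 * i + 1" using odd_M[OF k] by (elim oddE)
    then have "h + h = l + M k * l" by (simp add: h_def algebra_simps)
    then have hh: "x k [^] h \<otimes> x k [^] h = x k [^] l"
      using x_pow_mod[OF k, of "h + h"] x_pow_mod[OF k, of l] k
      by (simp add: nat_pow_mult x_closed)
    let ?c = "ev q \<otimes> x k [^] h"
    have c: "?c \<in> carrier G" using q k x_closed by simp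
    have "inv (x k [^] h) = t \<otimes> x k [^] h \<otimes> t"
      using k by (simp add: t_pow_t t_x_t x_closed nat_pow_inv)
    moreover have "inv (ev q) = t \<otimes> ev (rev q) \<otimes> t"
      using q by (simp add: t_ev_t inv_ev rev_map)
    ultimately have "?c \<otimes> t \<otimes> inv ?c = ev q \<otimes> (x k [^] h \<otimes> x k [^] h) \<otimes> ev (rev q) \<otimes> t"
      using q k by (simp add: inv_mult_group x_closed m_assoc)
    also have "\<dots> = ev (q @ [(k, l)] @ rev q) \<otimes> t"
      using hh q k reduced_fst[OF q] by (simp add: ev_append x_closed m_assoc)
    finally show ?thesis using c 2 \<open>g = ev w \<otimes> t\<close> by metis
  qed
qed

text \<open>Conjugating by \<open>q\<close> and merging the two adjacent copies of the last syllable of \<open>rev q\<close>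
  gives a cyclically reduced word.\<close>
lemma torsion_palindrome:
  assumes w: "reduced K M (q @ [a] @ rev q)" and n: "ev (q @ [a] @ rev q) [^] (n::nat) = \<one>" "n > 0"
  shows "q = []"
proof (rule ccontr)
  assume "q \<noteq> []"
  then obtain b v where q: "q = b # v" by (cases q) auto
  \<comment> \<open>The two copies of \<open>b\<close> that meet in \<open>rev q @ q\<close>,
    merged. The exponent stays nonzero because \<open>M (fst b)\<close> is odd.\<close>
  define b2 where "b2 = (fst b, 2 * snd b mod M (fst b))"
  \<comment> \<open>The palindrome conjugated by \<open>ev q\<close>: the leading \<open>q\<close>
    moves to the end, and \<open>rev q @ q\<close> collapses around \<open>b2\<close>.\<close>
  let ?z = "a # rev v @ [b2] @ v"
  have b: "fst b \<in> K" "0 < snd b" "snd b < M (fst b)" and rq: "reduced K M q"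
    using w q by (auto simp: reduced_Cons reduced_append)
  have "\<not> M (fst b) dvd 2 * snd b"
  proof
    assume "M (fst b) dvd 2 * snd b"
    moreover have "coprime (M (fst b)) 2" using odd_M[OF b(1)] by simp
    ultimately have "M (fst b) dvd snd b" using coprime_dvd_mult_right_iff by blast
    then show False using b by (auto dest: dvd_imp_le)
  qed
  then have b2: "reduced K M [b2]" using b by (auto simp: b2_def reduced_Cons dvd_eq_mod_eq_0)
  have z: "reduced K M ?z"
    using w b2 unfolding q
    by (auto simp: reduced_Cons reduced_append b2_def hd_append last_rev hd_rev)
  \<comment> \<open>The last syllable of \<open>?z\<close> lies in the factor of the last syllable
    of \<open>q\<close>, which is a neighbour of \<open>a\<close> in the palindrome.\<close>
  have "fst (last ?z) \<noteq> fst (hd ?z)"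
    using w unfolding q
    by (auto simp: reduced_Cons reduced_append b2_def hd_append last_rev hd_rev)
  then have zr: "reduced K M (concat (replicate n ?z))"
    using z reduced_concat_replicate by blast
  have fK: "fst ` set q \<subseteq> K" "fst ` set v \<subseteq> K" "fst a \<in> K"
    using w q reduced_fst by (auto simp: reduced_Cons reduced_append)
  have "ev ?z = inv (ev q) \<otimes> ev (q @ [a] @ rev q) \<otimes> ev q"
  proof -
    have "x (fst b) [^] snd b \<otimes> x (fst b) [^] snd b = ev [b2]"
      using b x_pow_mod[OF b(1), of "2 * snd b"] by (simp add: b2_def nat_pow_mult x_closed mult_2)
    then have "ev (rev q) \<otimes> ev q = ev (rev v) \<otimes> ev [b2] \<otimes> ev v"
      using fK b unfolding q
      by (simp add: ev_append ev_closed x_closed m_assoc) (simp add: ev_closed x_closed m_assoc[symmetric] b2_def)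
    then have "ev ?z = ev [a] \<otimes> (ev (rev q) \<otimes> ev q)"
      using fK b by (simp add: ev_append ev_closed x_closed m_assoc b2_def)
    also have "\<dots> = inv (ev q) \<otimes> (ev q \<otimes> (ev [a] \<otimes> (ev (rev q) \<otimes> ev q)))"
      using fK ev_closed by (simp add: m_assoc[symmetric] x_closed)
    also have "\<dots> = inv (ev q) \<otimes> ev (q @ [a] @ rev q) \<otimes> ev q"
      using fK ev_closed by (simp add: ev_append x_closed m_assoc)
    finally show ?thesis .
  qed
  then have "ev ?z [^] n = \<one>"
    using conj_nat_pow[of "ev q" "ev (q @ [a] @ rev q)" n] n(1) w rq by simp
  moreover have "ev (concat (replicate n ?z)) = ev ?z [^] n" for n
  proof (induction n)
    case (Suc n)
    have "fst ` set (concat (replicate n ?z)) \<subseteq> K" "fst ` set ?z \<subseteq> K"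
      using reduced_fst[OF z] by (auto simp: set_concat)
    then have "ev (?z @ concat (replicate n ?z)) = ev ?z \<otimes> ev (concat (replicate n ?z))"
      by (rule ev_append[rotated])
    then have "ev (concat (replicate (Suc n) ?z)) = ev ?z \<otimes> ev ?z [^] n"
      by (simp only: Suc.IH replicate.simps concat.simps)
    then show ?case by (simp only: nat_pow_Suc2[OF ev_closed'[OF z]])
  qed simp
  ultimately have "ev (concat (replicate n ?z)) = ev []" by (simp only: syl_prod.simps)
  then have "concat (replicate n ?z) = []" using zr syl_prod_inj reduced_Nil by blast
  then show False using n(2) by (cases n) auto
qed

text \<open>Among the elements \<open>ev w\<close>, inversion by \<open>t\<close> forces a
  palindrome and torsion shortens it to at most one syllable. Among the elements \<open>ev w\<close>
  times \<open>t\<close>, inversion by \<open>t\<close> alone leaves only \<open>t\<close>.\<close>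

lemma finite_inverted_torsion:
  "finite {y \<in> carrier G. t \<otimes> y \<otimes> t = inv y \<and> (\<exists>k > (0::nat). y [^] k = \<one>)}" (is "finite ?S")
proof (rule finite_subset)
  show "?S \<subseteq> {t, \<one>} \<union> (\<lambda>(k, l). x k [^] l) ` (SIGMA k : K. {..<M k})"
  proof
    fix y assume "y \<in> ?S"
    then obtain n :: nat where y: "y \<in> carrier G" "t \<otimes> y \<otimes> t = inv y" and n: "y [^] n = \<one>" "n > 0"
      by auto
    from y(1) show "y \<in> {t, \<one>} \<union> (\<lambda>(k, l). x k [^] l) ` (SIGMA k : K. {..<M k})"
    proof (cases rule: normal_form_cases)
      case (1 w)
      then have "ev w = inv (ev (map (inv_syl M) w))" using y t_ev_t by (metis inv_inv)
      then have "w = rev w" using 1 syl_prod_inj by (simp only: inv_ev_inv_syl reduced_rev)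
      with 1(1) show ?thesis
      proof (cases rule: reduced_palindrome_cases)
        case (2 q k l)
        then have "q = []" using torsion_palindrome 1 n by blast
        then have "y = x k [^] l" "k \<in> K" "l < M k"
          using 1 2 by (auto simp: x_closed reduced_Cons)
        then show ?thesis by auto
      qed (use 1 in simp)
    next
      case (2 w)
      \<comment> \<open>Cancelling \<open>t\<close> shows that \<open>ev w\<close> is its own
        inverse, hence trivial.\<close>
      have "t \<otimes> ev w = inv (ev w \<otimes> t)" using y 2 t_sq by (simp add: m_assoc)
      also have "\<dots> = t \<otimes> inv (ev w)" using 2 by (simp add: inv_mult_group)
      finally have "inv (ev w) = ev w" using 2 by simp
      then have "w = []" using self_inverse_ev 2 by blast
      then show ?thesis using 2 by simp
    qed
  qed
  show "finite ({t, \<one>} \<union> (\<lambda>(k, l). x k [^] l) ` (SIGMA k : K. {..<M k}))"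
    using finite_K by auto
qed

theorem is_co_hopfian: "co_hopfian G"
proof (rule co_hopfian_if_finite_inverted_torsion[OF _ t_sq t_neq_one _ refl])
  let ?S = "{y \<in> carrier G. t \<otimes> y \<otimes> t = inv y \<and> (\<exists>k > (0::nat). y [^] k = \<one>)}"
  show "finite ?S" by (rule finite_inverted_torsion)
  have "t [^] (2::nat) = \<one>" using t_sq by (simp add: numeral_2_eq_2)
  then have "t \<in> ?S" using t_sq by (auto intro!: exI[of _ "2::nat"])
  moreover have "x k \<in> ?S" if "k \<in> K" for k
    using that x_closed t_x_t x_pow odd_pos[OF odd_M] by blast
  ultimately have "insert t (x ` K) \<subseteq> ?S" by blast
  then show "generate G ?S = carrier G"
    using generated mono_generate generate_incl[of ?S] by blast
qed (auto intro: involution_conjugate)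

end

section \<open>Presented groups\<close>

lemma pres_eq_append_context: "pres_eq rels u v \<Longrightarrow> pres_eq rels (a @ u @ b) (a @ v @ b)"
proof (induction rule: pres_eq.induct)
  case (pres_rel l r u v)
  then show ?case using pres_eq.pres_rel[of l r rels "a @ u" "v @ b"] by simp
qed (blast intro: pres_eq.intros)+

lemma pres_eq_append:
  assumes "pres_eq rels u u'" "pres_eq rels v v'"
  shows "pres_eq rels (u @ v) (u' @ v')"
  using pres_eq_append_context[OF assms(1), of "[]" v] pres_eq_append_context[OF assms(2), of u' "[]"]
  by (auto intro: pres_eq.pres_trans)

abbreviation word_class :: "(nat list \<times> nat list) set \<Rightarrow> nat list \<Rightarrow> nat list set" where
  "word_class rels u \<equiv> pres_rel_set rels `` {u}"

lemma equiv_pres_rel_set: "equiv UNIV (pres_rel_set rels)"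
  by (auto simp: pres_rel_set_def equiv_def refl_on_def sym_def trans_def intro: pres_eq.intros)

lemma word_class_eq_iff: "word_class rels u = word_class rels v \<longleftrightarrow> pres_eq rels u v"
  using equiv_class_eq_iff[OF equiv_pres_rel_set, of u v rels] by (auto simp: pres_rel_set_def)

lemma carrier_presented_group: "carrier (presented_group n rels) = word_class rels ` lists {..<n}"
  by (auto simp: presented_group_def quotient_def)

lemma one_presented_group: "\<one>\<^bsub>presented_group n rels\<^esub> = word_class rels []"
  by (simp add: presented_group_def)

lemma mult_presented_group:
  "word_class rels u \<otimes>\<^bsub>presented_group n rels\<^esub> word_class rels v = word_class rels (u @ v)"
proof -
  have *: "word_class rels (a @ b) = word_class rels (u @ v)"
    if "(u, a) \<in> pres_rel_set rels" "(v, b) \<in> pres_rel_set rels" for a b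
  proof -
    have "pres_eq rels (u @ v) (a @ b)"
      using that by (intro pres_eq_append) (simp_all add: pres_rel_set_def)
    then show ?thesis unfolding word_class_eq_iff by (rule pres_eq.pres_sym)
  qed
  have "(\<Union>a\<in>word_class rels u. \<Union>b\<in>word_class rels v. word_class rels (a @ b)) =
      (\<Union>a\<in>word_class rels u. \<Union>b\<in>word_class rels v. word_class rels (u @ v))"
    using * by (intro SUP_cong refl) simp
  also have "\<dots> = word_class rels (u @ v)"
  proof -
    have "word_class rels u \<noteq> {}" "word_class rels v \<noteq> {}"
      using pres_eq.pres_refl by (auto simp: pres_rel_set_def)
    then show ?thesis by simp
  qed
  finally show ?thesis by (simp add: presented_group_def)
qed

text \<open>With involutions as generators, the reversed word represents the inverse.\<close>

lemma group_presented_group: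
  assumes "\<And>i. i < n \<Longrightarrow> pres_eq rels [i, i] []"
  shows "group (presented_group n rels)"
proof (rule groupI)
  fix A assume "A \<in> carrier (presented_group n rels)"
  then obtain u where u: "u \<in> lists {..<n}" "A = word_class rels u"
    by (auto simp: carrier_presented_group)
  have "pres_eq rels (rev u @ u) []" using u(1)
  proof (induction u)
    case (Cons i u)
    have "pres_eq rels (rev u @ [i, i] @ u) (rev u @ [] @ u)"
      using Cons assms by (intro pres_eq_append_context) auto
    then show ?case using Cons by (auto intro: pres_eq.pres_trans)
  qed (simp add: pres_eq.pres_refl)
  moreover have "word_class rels (rev u) \<in> carrier (presented_group n rels)"
    using u by (auto simp: carrier_presented_group)
  ultimately show "\<exists>B\<in>carrier (presented_group n rels).
      B \<otimes>\<^bsub>presented_group n rels\<^esub> A = \<one>\<^bsub>presented_group n rels\<^esub>"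
    using u(2) by (intro bexI[of _ "word_class rels (rev u)"])
      (simp_all add: mult_presented_group one_presented_group word_class_eq_iff)
qed (auto simp: carrier_presented_group one_presented_group mult_presented_group intro!: imageI)

primrec letter_prod :: "('a, 'b) monoid_scheme \<Rightarrow> (nat \<Rightarrow> 'a) \<Rightarrow> nat list \<Rightarrow> 'a" where
  "letter_prod G a [] = \<one>\<^bsub>G\<^esub>"
| "letter_prod G a (i # u) = a i \<otimes>\<^bsub>G\<^esub> letter_prod G a u"

lemma (in group) letter_prod_closed [simp]:
  "(\<And>i. a i \<in> carrier G) \<Longrightarrow> letter_prod G a u \<in> carrier G"
  by (induction u) auto

lemma (in group) letter_prod_append:
  "(\<And>i. a i \<in> carrier G) \<Longrightarrow> letter_prod G a (u @ v) = letter_prod G a u \<otimes> letter_prod G a v"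
  by (induction u) (auto simp: m_assoc)

lemma (in group) letter_prod_cox_relator:
  assumes "\<And>i. a i \<in> carrier G"
  shows "letter_prod G a (cox_relator i j k) = (a i \<otimes> a j) [^] k"
proof (induction k)
  case (Suc k)
  have "letter_prod G a (cox_relator i j (Suc k)) = a i \<otimes> a j \<otimes> (a i \<otimes> a j) [^] k"
    using Suc assms by (simp add: cox_relator_def m_assoc)
  then show ?case using nat_pow_Suc2 assms by simp
qed (simp add: cox_relator_def)

text \<open>The universal property of a presentation. The map \<open>a\<close> takes values in the
  carrier on all letters, because \<open>pres_eq\<close> does not restrict its words to letters
  below \<open>n\<close>.\<close>

lemma (in group) presented_group_hom_exists:
  assumes a: "\<And>i. a i \<in> carrier G"
    and rels: "\<And>l r. (l, r) \<in> rels \<Longrightarrow> letter_prod G a l = letter_prod G a r"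
  obtains \<phi> where "\<phi> \<in> hom (presented_group n rels) G" "\<And>i. i < n \<Longrightarrow> \<phi> (word_class rels [i]) = a i"
proof -
  have eq: "letter_prod G a u = letter_prod G a v" if "pres_eq rels u v" for u v
    using that by induction (auto simp: letter_prod_append a rels)
  \<comment> \<open>\<open>letter_prod\<close> is constant on a class, so the image is a
    singleton.\<close>
  define \<phi> where "\<phi> A = the_elem (letter_prod G a ` A)" for A
  have \<phi>: "\<phi> (word_class rels u) = letter_prod G a u" for u
  proof -
    have "letter_prod G a v = letter_prod G a u" if "v \<in> word_class rels u" for v
      using that eq[of u v] by (simp add: pres_rel_set_def)
    moreover have "u \<in> word_class rels u" by (simp add: pres_rel_set_def pres_eq.pres_refl)
    ultimately have "letter_prod G a ` word_class rels u = {letter_prod G a u}" by blast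
    then show ?thesis by (simp add: \<phi>_def)
  qed
  have "\<phi> \<in> hom (presented_group n rels) G"
    by (auto simp: hom_def carrier_presented_group mult_presented_group \<phi> letter_prod_append a)
  moreover have "\<phi> (word_class rels [i]) = a i" for i using \<phi> a by simp
  ultimately show ?thesis using that by blast
qed

section \<open>The action on reduced words\<close>

text \<open>Every syllable acts by removing the leading syllable of its own factor, if there is one, and
  putting back the sum of the exponents.\<close>

definition strip_head :: "'k \<Rightarrow> ('k \<times> nat) list \<Rightarrow> nat \<times> ('k \<times> nat) list" where
  "strip_head k w = (if w \<noteq> [] \<and> fst (hd w) = k then (snd (hd w), tl w) else (0, w))"

definition add_head :: "('k \<Rightarrow> nat) \<Rightarrow> 'k \<Rightarrow> nat \<Rightarrow> ('k \<times> nat) list \<Rightarrow> ('k \<times> nat) list" where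
  "add_head M k j w = (if j mod M k = 0 then w else (k, j mod M k) # w)"

definition act :: "('k \<Rightarrow> nat) \<Rightarrow> 'k \<Rightarrow> nat \<Rightarrow> ('k \<times> nat) list \<Rightarrow> ('k \<times> nat) list" where
  "act M k l w = add_head M k (l + fst (strip_head k w)) (snd (strip_head k w))"

lemma strip_head_reduced:
  assumes "reduced K M w"
  shows "reduced K M (snd (strip_head k w))"
    and "snd (strip_head k w) = [] \<or> fst (hd (snd (strip_head k w))) \<noteq> k"
    and "k \<in> K \<Longrightarrow> M k > 0 \<Longrightarrow> fst (strip_head k w) < M k"
    and "M k > 0 \<Longrightarrow> add_head M k (fst (strip_head k w)) (snd (strip_head k w)) = w"
  using assms by (cases w; auto simp: strip_head_def add_head_def reduced_Cons)+

lemma strip_head_add_head: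
  "w = [] \<or> fst (hd w) \<noteq> k \<Longrightarrow> strip_head k (add_head M k j w) = (j mod M k, w)"
  by (auto simp: strip_head_def add_head_def)

lemma act_reduced:
  assumes "reduced K M w" "k \<in> K" "M k > 0"
  shows "reduced K M (act M k l w)"
  using assms strip_head_reduced[OF assms(1), of k]
  by (auto simp: act_def add_head_def reduced_Cons)

text \<open>For fixed \<open>k\<close> the maps \<open>act M k l\<close> thus form an action of the
  cyclic group of order \<open>M k\<close>.\<close>

lemma act_act:
  assumes "reduced K M w" "k \<in> K" "M k > 0"
  shows "act M k l (act M k l' w) = act M k (l + l') w"
proof -
  have "strip_head k (act M k l' w) = ((l' + fst (strip_head k w)) mod M k, snd (strip_head k w))"
    unfolding act_def using strip_head_reduced(2)[OF assms(1)] by (intro strip_head_add_head)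
  then show ?thesis by (simp add: act_def add_head_def mod_add_right_eq add.assoc)
qed

lemma act_0: "reduced K M w \<Longrightarrow> M k > 0 \<Longrightarrow> act M k 0 w = w"
  using strip_head_reduced(4) by (simp add: act_def)

lemma act_Cons:
  assumes "reduced K M (s # w)"
  shows "act M (fst s) (snd s) w = s # w"
  using assms by (cases s) (auto simp: act_def strip_head_def add_head_def reduced_Cons)

text \<open>The word version of \<open>t\<close> inverting \<open>x k\<close>: splitting
  \<open>w\<close> into a leading exponent \<open>j\<close> and a rest \<open>v\<close>, both sides
  put exponent \<open>j - l\<close> modulo \<open>M k\<close> in front of \<open>v\<close>.\<close>

lemma map_inv_syl_act:
  assumes w: "reduced K M w" and k: "k \<in> K" "M k > 0" "l \<le> M k"
  shows "map (inv_syl M) (act M k l (map (inv_syl M) w)) = act M k (M k - l) w"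
proof -
  define j v where "j = fst (strip_head k w)" and "v = snd (strip_head k w)"
  have v: "reduced K M v" "v = [] \<or> fst (hd v) \<noteq> k" "j < M k" and wv: "w = add_head M k j v"
    using strip_head_reduced[OF w, of k] k unfolding j_def v_def by auto
  have vm: "map (inv_syl M) v = [] \<or> fst (hd (map (inv_syl M) v)) \<noteq> k"
    using v(2) by (cases v) auto
  \<comment> \<open>For \<open>i = 0\<close> the new exponent is \<open>M k\<close>, which
    \<open>add_head\<close> reduces to no syllable.\<close>
  have m: "map (inv_syl M) (add_head M k i u) = add_head M k (M k - i) (map (inv_syl M) u)"
    if "i < M k" for i u
    using that by (auto simp: add_head_def inv_syl_def)
  have "act M k l (map (inv_syl M) w) = add_head M k (l + (M k - j) mod M k) (map (inv_syl M) v)"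
    unfolding act_def wv using m[OF v(3), of v] strip_head_add_head[OF vm] by simp
  also have "\<dots> = add_head M k ((l + (M k - j)) mod M k) (map (inv_syl M) v)"
    by (simp add: add_head_def mod_add_right_eq)
  finally have "map (inv_syl M) (act M k l (map (inv_syl M) w)) =
      add_head M k (M k - (l + (M k - j)) mod M k) v"
    using m[of "(l + (M k - j)) mod M k"] k inv_syl_inv_syl[OF v(1)] by simp
  also have "\<dots> = add_head M k (M k - l + j) v"
  proof -
    \<comment> \<open>The congruence is computed in the integers to avoid truncated
      subtraction.\<close>
    have "int (M k - (l + (M k - j)) mod M k) mod int (M k) = int (M k - l + j) mod int (M k)"
    proof -
      have "(l + (M k - j)) mod M k \<le> M k" using k by (simp add: order_less_imp_le)
      then have "int (M k - (l + (M k - j)) mod M k) mod int (M k) =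
          (int (M k) - (int l + (int (M k) - int j)) mod int (M k)) mod int (M k)"
        using v(3) by (simp add: of_nat_diff of_nat_mod add_diff_eq)
      also have "\<dots> = (int (M k) - (int l + (int (M k) - int j))) mod int (M k)"
        by (simp only: mod_diff_right_eq)
      also have "\<dots> = (int j - int l) mod int (M k)" by simp
      also have "\<dots> = (int j - int l + int (M k)) mod int (M k)" by (simp only: mod_add_self2)
      also have "int j - int l + int (M k) = int (M k - l + j)" using k(3) by simp
      finally show ?thesis .
    qed
    then have "(M k - (l + (M k - j)) mod M k) mod M k = (M k - l + j) mod M k"
      by (metis of_nat_eq_iff of_nat_mod)
    then show ?thesis by (simp add: add_head_def)
  qed
  finally show ?thesis by (simp add: act_def j_def v_def)
qed

section \<open>A permutation model of the semidirect product\<close>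

lemma mult_BijGroup:
  "f \<in> carrier (BijGroup S) \<Longrightarrow> g \<in> carrier (BijGroup S) \<Longrightarrow> f \<otimes>\<^bsub>BijGroup S\<^esub> g = compose S f g"
  by (simp add: BijGroup_def)

lemma restrict_mem_BijGroup:
  assumes "\<And>z. z \<in> S \<Longrightarrow> f z \<in> S \<and> g z \<in> S \<and> f (g z) = z \<and> g (f z) = z"
  shows "restrict f S \<in> carrier (BijGroup S)"
proof -
  have "bij_betw f S S" using assms by (intro bij_betw_byWitness[where f' = g]) auto
  then have "bij_betw (restrict f S) S S" using bij_betw_cong[of S "restrict f S" f S] by simp
  then show ?thesis by (simp add: BijGroup_def Bij_def)
qed

text \<open>Van der Waerden's method: syllables act on reduced words, and \<open>t\<close> inverts
  all syllables while flipping a bit. \<open>N\<close> evaluates a permutation at the empty word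
  with bit \<open>False\<close>, which returns the normal form.\<close>

lemma word_action_exists:
  fixes K :: "'k set" and M :: "'k \<Rightarrow> nat"
  assumes M_pos: "\<And>k. k \<in> K \<Longrightarrow> M k > 0"
  obtains H :: "(('k \<times> nat) list \<times> bool \<Rightarrow> ('k \<times> nat) list \<times> bool) monoid" and t x N
  where "group H" "t \<in> carrier H" "t \<otimes>\<^bsub>H\<^esub> t = \<one>\<^bsub>H\<^esub>"
    "\<And>k. k \<in> K \<Longrightarrow> x k \<in> carrier H" "\<And>k. k \<in> K \<Longrightarrow> x k [^]\<^bsub>H\<^esub> M k = \<one>\<^bsub>H\<^esub>"
    "\<And>k. k \<in> K \<Longrightarrow> t \<otimes>\<^bsub>H\<^esub> x k \<otimes>\<^bsub>H\<^esub> t = inv\<^bsub>H\<^esub> (x k)"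
    "\<And>w. reduced K M w \<Longrightarrow> N (syl_prod H x w) = (w, False)"
    "\<And>w. reduced K M w \<Longrightarrow> N (syl_prod H x w \<otimes>\<^bsub>H\<^esub> t) = (w, True)"
proof -
  define \<Omega> :: "(('k \<times> nat) list \<times> bool) set" where "\<Omega> = {z. reduced K M (fst z)}"
  define H where "H = BijGroup \<Omega>"
  interpret group H unfolding H_def by (rule group_BijGroup)
  define t where "t = (\<lambda>z \<in> \<Omega>. (map (inv_syl M) (fst z), \<not> snd z))"
  define y where "y k l = (\<lambda>z \<in> \<Omega>. (act M k l (fst z), snd z))" for k l
  have t: "t \<in> carrier H" unfolding H_def t_def
    by (rule restrict_mem_BijGroup[where g = "\<lambda>z. (map (inv_syl M) (fst z), \<not> snd z)"])
      (simp add: \<Omega>_def reduced_map_inv_syl inv_syl_inv_syl del: map_map)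
  have act_period: "act M k (j * M k) w = w" if "reduced K M w" "k \<in> K" for j k w

  proof -
    have "act M k (j * M k) w = act M k 0 w" by (simp add: act_def add_head_def)
    then show ?thesis using act_0 that M_pos by metis
  qed
  have y: "y k l \<in> carrier H" if k: "k \<in> K" for k l
  proof -
    \<comment> \<open>The inverse of \<open>y k l\<close> has exponent \<open>(M k - 1) * l\<close>,
      as the two exponents add up to a multiple of \<open>M k\<close>.\<close>
    have 1: "l + (M k - Suc 0) * l = l * M k" "(M k - Suc 0) * l + l = l * M k"
      using M_pos[OF k] by (simp_all add: algebra_simps diff_mult_distrib)
    show ?thesis unfolding H_def y_def
      by (rule restrict_mem_BijGroup[where g = "\<lambda>z. (act M k ((M k - 1) * l) (fst z), snd z)"])
        (simp add: \<Omega>_def act_reduced act_act act_period k M_pos 1)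
  qed
  have mult: "(f \<otimes>\<^bsub>H\<^esub> g) (w, b) = f (g (w, b))"
    if "f \<in> carrier H" "g \<in> carrier H" "reduced K M w" for f g w b
    using that by (simp add: H_def mult_BijGroup compose_def \<Omega>_def)
  have ext: "f = g"
    if "f \<in> carrier H" "g \<in> carrier H" "\<And>w b. reduced K M w \<Longrightarrow> f (w, b) = g (w, b)" for f g
    using that unfolding H_def BijGroup_def Bij_def by (auto simp: \<Omega>_def intro!: extensionalityI[of f \<Omega> g])
  have one: "\<one>\<^bsub>H\<^esub> (w, b) = (w, b)" if "reduced K M w" for w b
    using that by (simp add: H_def BijGroup_def \<Omega>_def)
  have yz: "y k l (w, b) = (act M k l w, b)" if "reduced K M w" for k l w b
    using that by (simp add: y_def \<Omega>_def)
  have tz: "t (w, b) = (map (inv_syl M) w, \<not> b)" if "reduced K M w" for w b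
    using that by (simp add: t_def \<Omega>_def)
  have t_sq: "t \<otimes>\<^bsub>H\<^esub> t = \<one>\<^bsub>H\<^esub>"
    by (rule ext) (simp_all add: t mult tz one reduced_map_inv_syl inv_syl_inv_syl del: map_map)
  have y_mult: "y k l \<otimes>\<^bsub>H\<^esub> y k l' = y k (l + l')" if "k \<in> K" for k l l'
    using that M_pos by (intro ext) (simp_all add: y mult yz act_reduced act_act)
  have y_period: "y k (j * M k) = \<one>\<^bsub>H\<^esub>" if "k \<in> K" for k j
    using that by (intro ext) (simp_all add: y one yz act_period)
  have y_pow: "y k 1 [^]\<^bsub>H\<^esub> l = y k l" if "k \<in> K" for k and l :: nat
    using that y_period[of k 0] by (induction l) (simp_all add: y_mult)
  have tyt: "t \<otimes>\<^bsub>H\<^esub> y k 1 \<otimes>\<^bsub>H\<^esub> t = inv\<^bsub>H\<^esub> (y k 1)" if k: "k \<in> K" for k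
  proof -
    have M1: "1 \<le> M k" using M_pos[OF k] by simp
    have "t \<otimes>\<^bsub>H\<^esub> y k 1 \<otimes>\<^bsub>H\<^esub> t = y k (M k - 1)"
    proof (rule ext)
      fix w b assume w: "reduced K M w"
      then have "map (inv_syl M) (act M k 1 (map (inv_syl M) w)) = act M k (M k - 1) w"
        using k M_pos M1 by (intro map_inv_syl_act) auto
      then show "(t \<otimes>\<^bsub>H\<^esub> y k 1 \<otimes>\<^bsub>H\<^esub> t) (w, b) = y k (M k - 1) (w, b)"
        using w k M_pos
        by (simp add: t y mult tz yz reduced_map_inv_syl act_reduced del: map_map One_nat_def)
    qed (simp_all add: t y k)
    moreover have "y k (M k - 1) \<otimes>\<^bsub>H\<^esub> y k 1 = \<one>\<^bsub>H\<^esub>"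
      using y_period[OF k, of 1] M1 k by (simp add: y_mult)
    ultimately show ?thesis using inv_equality y k by simp
  qed
  have sp: "syl_prod H (\<lambda>k. y k 1) w \<in> carrier H \<and> syl_prod H (\<lambda>k. y k 1) w ([], b) = (w, b)"
    if "reduced K M w" for w b
    using that
  proof (induction w)
    case Nil
    then show ?case by (simp add: one)
  next
    case (Cons s w)
    then show ?case using act_Cons[OF Cons.prems]
      by (simp add: reduced_Cons y_pow y mult yz del: One_nat_def)
  qed
  show ?thesis
  proof (rule that[of H t "\<lambda>k. y k 1" "\<lambda>f. f ([], False)"])
    fix w assume w: "reduced K M w"
    show "syl_prod H (\<lambda>k. y k 1) w ([], False) = (w, False)" using sp w by blast
    show "(syl_prod H (\<lambda>k. y k 1) w \<otimes>\<^bsub>H\<^esub> t) ([], False) = (w, True)"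
      using sp[OF w] by (simp add: mult t tz)
  qed (use y_period[of _ 1] in \<open>simp_all add: t y t_sq tyt y_pow group_axioms del: One_nat_def\<close>)
qed

text \<open>Recursion along the parent map towards the root 0, well founded because the depth
  \<open>d\<close> drops.\<close>

lemma ex_parent_recursion:
  fixes d :: "nat \<Rightarrow> nat"
  assumes "\<And>k. 0 < k \<Longrightarrow> k < n \<Longrightarrow> d (p k) < d k"
  obtains c where "c 0 = a" "\<And>k. 0 < k \<Longrightarrow> k < n \<Longrightarrow> c k = F k (c (p k))"
proof -
  define c where "c = wfrec (measure d) (\<lambda>f k. if k = 0 then a else F k (f (p k)))"
  have c: "c k = (if k = 0 then a else F k (cut c (measure d) k (p k)))" for k
    unfolding c_def by (subst wfrec) simp_all
  show ?thesis using that[of c] c assms by (simp add: cut_apply)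
qed

section \<open>Coxeter groups of odd trees\<close>

text \<open>\<open>c k\<close> conjugates \<open>s 0\<close> to \<open>s k\<close>, and \<open>x k\<close> is the rotation of the edge from \<open>p k\<close> to \<open>k\<close>, carried
  back so that its dihedral group contains \<open>s 0\<close>.\<close>
lemma (in group) twisted_generators:
  fixes s :: "nat \<Rightarrow> 'a" and p d M h :: "nat \<Rightarrow> nat"
  assumes s: "\<And>i. i < n \<Longrightarrow> s i \<in> carrier G" "\<And>i. i < n \<Longrightarrow> s i \<otimes> s i = \<one>"
    and p: "\<And>k. 0 < k \<Longrightarrow> k < n \<Longrightarrow> p k < n" "\<And>k. 0 < k \<Longrightarrow> k < n \<Longrightarrow> d (p k) < d k"
    and rel: "\<And>k. 0 < k \<Longrightarrow> k < n \<Longrightarrow> (s k \<otimes> s (p k)) [^] M k = \<one>"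
    and h: "\<And>k. 0 < k \<Longrightarrow> k < n \<Longrightarrow> 2 * h k = M k + 1"
    and c: "c 0 = \<one>" "\<And>k. 0 < k \<Longrightarrow> k < n \<Longrightarrow> c k = (s k \<otimes> s (p k)) [^] h k \<otimes> c (p k)"
    and x: "\<And>k. x k = inv (c (p k)) \<otimes> (s k \<otimes> s (p k)) \<otimes> c (p k)"
    and n: "n > 0"
  shows "k < n \<Longrightarrow> c k \<in> carrier G"
    and "0 < k \<Longrightarrow> k < n \<Longrightarrow> x k \<in> carrier G"
    and "0 < k \<Longrightarrow> k < n \<Longrightarrow> x k [^] M k = \<one>"
    and "0 < k \<Longrightarrow> k < n \<Longrightarrow> s 0 \<otimes> x k \<otimes> s 0 = inv (x k)"
    and "s ` {..<n} \<subseteq> generate G (insert (s 0) (x ` {0<..<n}))"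
proof -
  have inv_s: "inv (s i) = s i" if "i < n" for i
    using s that inv_equality by blast
  show cc: "c k \<in> carrier G" if "k < n" for k
    using that
  proof (induction k rule: measure_induct_rule[of d])
    case (less k)
    then show ?case using c p s by (cases "k = 0") auto
  qed
  show xc: "x k \<in> carrier G" if "0 < k" "k < n" for k
    using that cc p s by (simp add: x)
  have x_pow: "x k [^] l = inv (c (p k)) \<otimes> (s k \<otimes> s (p k)) [^] l \<otimes> c (p k)"
    if "0 < k" "k < n" for k and l :: nat
    unfolding x using that cc p s by (intro conj_nat_pow) auto
  show "x k [^] M k = \<one>" if "0 < k" "k < n" for k
    using that x_pow[of k "M k"] rel cc p by simp
  \<comment> \<open>Expresses the conjugators through the \<open>x k\<close> alone; the permutation
    model later uses this form as its definition.\<close>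
  have c_x: "c k = c (p k) \<otimes> x k [^] h k" if "0 < k" "k < n" for k
  proof -
    have "c (p k) \<in> carrier G" "s k \<in> carrier G" "s (p k) \<in> carrier G" using that cc p s by auto
    then show ?thesis using that x_pow[of k "h k"] c(2)[of k]
      by (simp add: m_assoc[symmetric])
  qed
  have sc: "s k = c k \<otimes> s 0 \<otimes> inv (c k)" if "k < n" for k
    using that
  proof (induction k rule: measure_induct_rule[of d])
    case (less k)
    show ?case
    proof (cases "k = 0")
      case False
      let ?r = "s k \<otimes> s (p k)"
      have k: "0 < k" "p k < n" "s k \<in> carrier G" "s (p k) \<in> carrier G" "s 0 \<in> carrier G"
        "c (p k) \<in> carrier G" "?r \<in> carrier G"
        using False less.prems cc p s n by auto
      \<comment> \<open>A reflection inverts the rotations of its dihedral group.\<close>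
      have "s (p k) \<otimes> ?r \<otimes> s (p k) = inv ?r"
        using k less.prems s p by (simp add: inv_mult_group inv_s m_assoc)
      then have "s (p k) \<otimes> ?r [^] h k \<otimes> s (p k) = inv ?r [^] h k"
        using conj_nat_pow[of "s (p k)" ?r "h k"] k inv_s[of "p k"] by simp
      then have 1: "inv (?r [^] h k) = s (p k) \<otimes> ?r [^] h k \<otimes> s (p k)"
        using k by (simp add: nat_pow_inv)
      have "c k \<otimes> s 0 \<otimes> inv (c k) = ?r [^] h k \<otimes> (c (p k) \<otimes> s 0 \<otimes> inv (c (p k))) \<otimes> inv (?r [^] h k)"
        using c(2)[OF k(1) less.prems] k by (simp add: inv_mult_group m_assoc)
      also have "c (p k) \<otimes> s 0 \<otimes> inv (c (p k)) = s (p k)"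
        using less.IH[of "p k"] p k less.prems by simp
      also have "?r [^] h k \<otimes> s (p k) \<otimes> inv (?r [^] h k) =
          ?r [^] h k \<otimes> (s (p k) \<otimes> s (p k)) \<otimes> ?r [^] h k \<otimes> s (p k)"
        using k unfolding 1 by (simp only: m_assoc m_closed nat_pow_closed)
      also have "\<dots> = ?r [^] h k \<otimes> ?r [^] h k \<otimes> s (p k)"
        using s(2)[OF k(2)] k by simp
      \<comment> \<open>\<open>h k\<close> is half of \<open>M k + 1\<close>, so the square of this
        power is \<open>?r\<close> itself.\<close>
      also have "?r [^] h k \<otimes> ?r [^] h k = ?r [^] (M k + 1)"
        using k h[OF k(1) less.prems] by (simp add: nat_pow_mult mult_2)
      also have "\<dots> = ?r" using rel[OF k(1) less.prems] k by simp
      also have "?r \<otimes> s (p k) = s k" using k s(2)[OF k(2)] by (simp add: m_assoc)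
      finally show ?thesis by simp
    qed (use c s n in simp)
  qed
  show "s 0 \<otimes> x k \<otimes> s 0 = inv (x k)" if "0 < k" "k < n" for k
  proof -
    have k: "p k < n" "s k \<in> carrier G" "s (p k) \<in> carrier G" "s 0 \<in> carrier G" "c (p k) \<in> carrier G"
      using that cc p s n by auto
    \<comment> \<open>\<open>c (p k)\<close> carries \<open>s 0\<close> to \<open>s (p k)\<close>,
      which inverts the untwisted rotation.\<close>
    have "s (p k) \<otimes> c (p k) = c (p k) \<otimes> s 0 \<otimes> inv (c (p k)) \<otimes> c (p k)" using sc[OF k(1)] by simp
    also have "\<dots> = c (p k) \<otimes> s 0" using k by (simp add: m_assoc)
    finally have 1: "c (p k) \<otimes> s 0 = s (p k) \<otimes> c (p k)" ..
    have "inv (c (p k) \<otimes> s 0) = inv (s (p k) \<otimes> c (p k))" using 1 by simp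
    then have 2: "s 0 \<otimes> inv (c (p k)) = inv (c (p k)) \<otimes> s (p k)"
      using k n by (simp add: inv_mult_group inv_s)
    have "s 0 \<otimes> x k \<otimes> s 0 = (s 0 \<otimes> inv (c (p k))) \<otimes> (s k \<otimes> s (p k)) \<otimes> (c (p k) \<otimes> s 0)"
      using k by (simp add: x m_assoc)
    also have "\<dots> = inv (c (p k)) \<otimes> (s (p k) \<otimes> s k) \<otimes> (s (p k) \<otimes> s (p k)) \<otimes> c (p k)"
      unfolding 1 2 using k by (simp only: m_assoc m_closed inv_closed)
    also have "\<dots> = inv (x k)"
      using k that s(2)[OF k(1)] by (simp add: x inv_mult_group inv_s m_assoc)
    finally show ?thesis .
  qed
  let ?X = "insert (s 0) (x ` {0<..<n})"
  have X: "?X \<subseteq> carrier G" using s xc n by auto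
  interpret X: subgroup "generate G ?X" G using X by (rule generate_is_subgroup)
  have pow_mem: "y [^] l \<in> generate G ?X" if "y \<in> generate G ?X" for y and l :: nat
    using that by (induction l) auto
  have "c k \<in> generate G ?X" if "k < n" for k
    using that
  proof (induction k rule: measure_induct_rule[of d])
    case (less k)
    show ?case
    proof (cases "k = 0")
      case False
      then have "c (p k) \<in> generate G ?X" "x k \<in> generate G ?X"
        using less p by (auto intro: generate.incl)
      then show ?thesis using c_x[of k] False less.prems pow_mem by simp
    qed (simp add: c)
  qed
  moreover have "s 0 \<in> generate G ?X" by (auto intro: generate.incl)
  ultimately show "s ` {..<n} \<subseteq> generate G ?X"
    using sc by (metis (no_types, lifting) X.m_closed X.m_inv_closed image_subsetI lessThan_iff)
qed

lemma cox_relator_Suc: "cox_relator i j (Suc k) = cox_relator i j k @ [i, j]"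
  by (induction k) (auto simp: cox_relator_def)

lemma coxeter_group_generators:
  assumes cm: "coxeter_matrix n m" and s_def: "\<And>i. s i = word_class (coxeter_rels n m) [i]"
  shows "group (coxeter_group n m)"
    and "\<And>i. i < n \<Longrightarrow> s i \<in> carrier (coxeter_group n m)"
    and "\<And>i j k. i < n \<Longrightarrow> j < n \<Longrightarrow> m i j = enat k \<Longrightarrow>
      (s i \<otimes>\<^bsub>coxeter_group n m\<^esub> s j) [^]\<^bsub>coxeter_group n m\<^esub> k = \<one>\<^bsub>coxeter_group n m\<^esub>"
    and "generate (coxeter_group n m) (s ` {..<n}) = carrier (coxeter_group n m)"
proof -
  let ?R = "coxeter_rels n m" and ?G = "coxeter_group n m"
  have rel: "pres_eq ?R (cox_relator i j k) []" if "i < n" "j < n" "m i j = enat k" for i j k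
    using pres_eq.pres_rel[of "cox_relator i j k" "[]" ?R "[]" "[]"] that
    by (auto simp: coxeter_rels_def)
  show "group ?G" unfolding coxeter_group_def
  proof (rule group_presented_group)
    fix i assume "i < n"
    then have "m i i = enat 1" using cm by (simp add: coxeter_matrix_def one_enat_def)
    then show "pres_eq ?R [i, i] []"
      using rel[of i i 1] \<open>i < n\<close> by (simp add: cox_relator_def)
  qed
  then interpret group ?G .
  show s: "s i \<in> carrier ?G" if "i < n" for i
    using that by (auto simp: s_def coxeter_group_def carrier_presented_group intro!: imageI)
  have mult: "word_class ?R u \<otimes>\<^bsub>?G\<^esub> word_class ?R v = word_class ?R (u @ v)" for u v
    unfolding coxeter_group_def by (rule mult_presented_group)
  have one: "\<one>\<^bsub>?G\<^esub> = word_class ?R []"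
    unfolding coxeter_group_def by (rule one_presented_group)
  show "(s i \<otimes>\<^bsub>?G\<^esub> s j) [^]\<^bsub>?G\<^esub> k = \<one>\<^bsub>?G\<^esub>" if "i < n" "j < n" "m i j = enat k" for i j k
  proof -
    have "(s i \<otimes>\<^bsub>?G\<^esub> s j) [^]\<^bsub>?G\<^esub> l = word_class ?R (cox_relator i j l)" for l
      by (induction l) (simp_all only: nat_pow_0 nat_pow_Suc cox_relator_Suc s_def mult one,
          simp_all add: cox_relator_def)
    then show ?thesis using rel[OF that] by (simp add: one word_class_eq_iff)
  qed
  show "generate ?G (s ` {..<n}) = carrier ?G"
  proof
    show "generate ?G (s ` {..<n}) \<subseteq> carrier ?G"
      using s by (intro generate_incl) auto
    have "word_class ?R u \<in> generate ?G (s ` {..<n})" if "u \<in> lists {..<n}" for u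
      using that
    proof (induction u)
      case Nil
      show ?case unfolding one[symmetric] by (rule generate.one)
    next
      case (Cons i u)
      then have "s i \<in> generate ?G (s ` {..<n})" by (auto intro: generate.incl)
      then have "s i \<otimes>\<^bsub>?G\<^esub> word_class ?R u \<in> generate ?G (s ` {..<n})"
        using Cons.IH by (rule generate.eng)
      then show ?case by (simp add: s_def mult)
    qed
    then show "carrier ?G \<subseteq> generate ?G (s ` {..<n})"
      by (auto simp: coxeter_group_def carrier_presented_group)
  qed
qed

text \<open>The converse computation to the twisting: since \<open>t\<close> inverts powers of
  \<open>y\<close>, the product of the two reflections telescopes to the conjugate by
  \<open>g\<close> of the square of \<open>y [^] h\<close>.\<close>

lemma (in group) twisted_reflection_product:
  assumes "t \<in> carrier G" "t \<otimes> t = \<one>" "y \<in> carrier G" "t \<otimes> y \<otimes> t = inv y" "g \<in> carrier G"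
    and "y [^] (h::nat) \<otimes> y [^] h = y"
  shows "(g \<otimes> y [^] h \<otimes> t \<otimes> inv (g \<otimes> y [^] h)) \<otimes> (g \<otimes> t \<otimes> inv g) = g \<otimes> y \<otimes> inv g"
proof -
  have "inv t = t" using assms by (intro inv_equality) auto
  then have "inv y [^] h = t \<otimes> y [^] h \<otimes> t"
    using conj_nat_pow[of t y h] assms by simp
  then have i: "inv (y [^] h) = t \<otimes> y [^] h \<otimes> t" using assms by (simp add: nat_pow_inv)
  have tt: "t \<otimes> (t \<otimes> z) = z" if "z \<in> carrier G" for z
    using that assms by (simp add: m_assoc[symmetric])
  have "(g \<otimes> y [^] h \<otimes> t \<otimes> inv (g \<otimes> y [^] h)) \<otimes> (g \<otimes> t \<otimes> inv g) =
      g \<otimes> y [^] h \<otimes> t \<otimes> (inv (y [^] h) \<otimes> (inv g \<otimes> g) \<otimes> t \<otimes> inv g)"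
    using assms by (simp only: inv_mult_group m_assoc m_closed inv_closed nat_pow_closed)
  also have "\<dots> = g \<otimes> (y [^] h \<otimes> y [^] h) \<otimes> inv g"
    using assms(1-5) by (simp add: i m_assoc tt)
  finally show ?thesis using assms by simp
qed

text \<open>The tree is given by parents \<open>p\<close> and depths \<open>d\<close> with root 0. A
  homomorphism to the permutation model sends \<open>x k\<close> to \<open>X k\<close> and
  \<open>s 0\<close> to \<open>T\<close>, and pulls back uniqueness of normal forms.\<close>

theorem co_hopfian_coxeter_group:
  fixes p d :: "nat \<Rightarrow> nat"
  assumes n: "n > 0" and cm: "coxeter_matrix n m" and odd: "odd_coxeter n m"
    and p: "\<And>k. 0 < k \<Longrightarrow> k < n \<Longrightarrow> p k < n" "\<And>k. 0 < k \<Longrightarrow> k < n \<Longrightarrow> d (p k) < d k"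
      "\<And>k. 0 < k \<Longrightarrow> k < n \<Longrightarrow> m (p k) k \<noteq> \<infinity>"
    and tree: "\<And>i j. i < n \<Longrightarrow> j < n \<Longrightarrow> i \<noteq> j \<Longrightarrow> m i j \<noteq> \<infinity> \<Longrightarrow>
      0 < i \<and> p i = j \<or> 0 < j \<and> p j = i"
  shows "co_hopfian (coxeter_group n m)"
proof -
  let ?G = "coxeter_group n m"
  define K where "K = {0<..<n}"
  define M where "M k = the_enat (m (p k) k)" for k
  define h where "h k = (M k + 1) div 2" for k
  define s where "s i = word_class (coxeter_rels n m) [i]" for i
  note gens = coxeter_group_generators[OF cm s_def]
  have pk: "p k \<noteq> k" if "0 < k" "k < n" for k using p(2)[OF that] by auto
  have M: "m (p k) k = enat (M k)" "m k (p k) = enat (M k)" "odd (M k)" if k: "0 < k" "k < n" for k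
  proof -
    have "m (p k) k = \<infinity> \<or> (\<exists>l. m (p k) k = enat l \<and> odd l)"
      using odd p(1)[OF k] k pk[OF k] unfolding odd_coxeter_def by simp
    then obtain l where l: "m (p k) k = enat l" "odd l" using p(3)[OF k] by auto
    then show "m (p k) k = enat (M k)" "odd (M k)" by (simp_all add: M_def)
    moreover have "m k (p k) = m (p k) k"
      using cm p(1)[OF k] k(2) unfolding coxeter_matrix_def by blast
    ultimately show "m k (p k) = enat (M k)" by simp
  qed
  have h: "2 * h k = M k + 1" if "0 < k" "k < n" for k
    using M(3)[OF that] by (auto simp: h_def elim: oddE)
  have Mpos: "M k > 0" if "k \<in> K" for k using that M by (auto simp: K_def intro: odd_pos)
  have m_diag: "m i i = enat 1" if "i < n" for i
    using cm that by (simp add: coxeter_matrix_def one_enat_def)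

  interpret G: group ?G by (rule gens(1))
  have s: "s i \<in> carrier ?G" "s i \<otimes>\<^bsub>?G\<^esub> s i = \<one>\<^bsub>?G\<^esub>" if "i < n" for i
    using that gens(2)[of i] gens(3)[OF that that m_diag[OF that]] by simp_all
  obtain c where c: "c 0 = \<one>\<^bsub>?G\<^esub>" "\<And>k. 0 < k \<Longrightarrow> k < n \<Longrightarrow>
      c k = (s k \<otimes>\<^bsub>?G\<^esub> s (p k)) [^]\<^bsub>?G\<^esub> h k \<otimes>\<^bsub>?G\<^esub> c (p k)"
    using ex_parent_recursion[of n d p "\<one>\<^bsub>?G\<^esub>"
        "\<lambda>k g. (s k \<otimes>\<^bsub>?G\<^esub> s (p k)) [^]\<^bsub>?G\<^esub> h k \<otimes>\<^bsub>?G\<^esub> g"] p(2) by metis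
  define x where "x k = inv\<^bsub>?G\<^esub> c (p k) \<otimes>\<^bsub>?G\<^esub> (s k \<otimes>\<^bsub>?G\<^esub> s (p k)) \<otimes>\<^bsub>?G\<^esub> c (p k)" for k
  have rel: "(s k \<otimes>\<^bsub>?G\<^esub> s (p k)) [^]\<^bsub>?G\<^esub> M k = \<one>\<^bsub>?G\<^esub>" if "0 < k" "k < n" for k
    using gens(3) that p(1) M(2) by blast
  note tw = G.twisted_generators[where n = n and s = s and p = p and d = d and M = M and h = h and c = c and x = x,
      OF s p(1,2) rel h c x_def n]
  have x_closed: "x k \<in> carrier ?G" if "k \<in> K" for k using tw(2) that by (simp add: K_def)

  obtain H :: "((nat \<times> nat) list \<times> bool \<Rightarrow> (nat \<times> nat) list \<times> bool) monoid" and T X N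
    where "group H" and T: "T \<in> carrier H" "T \<otimes>\<^bsub>H\<^esub> T = \<one>\<^bsub>H\<^esub>"
      and X: "\<And>k. k \<in> K \<Longrightarrow> X k \<in> carrier H" "\<And>k. k \<in> K \<Longrightarrow> X k [^]\<^bsub>H\<^esub> M k = \<one>\<^bsub>H\<^esub>"
        "\<And>k. k \<in> K \<Longrightarrow> T \<otimes>\<^bsub>H\<^esub> X k \<otimes>\<^bsub>H\<^esub> T = inv\<^bsub>H\<^esub> (X k)"
      and N: "\<And>w. reduced K M w \<Longrightarrow> N (syl_prod H X w) = (w, False)"
        "\<And>w. reduced K M w \<Longrightarrow> N (syl_prod H X w \<otimes>\<^bsub>H\<^esub> T) = (w, True)"
    by (rule word_action_exists[of K M, OF Mpos]) (assumption, (rule that; assumption))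
  interpret H: group H by fact
  \<comment> \<open>The conjugators rebuilt inside \<open>H\<close>, with \<open>X k\<close> in
    place of \<open>x k\<close>.\<close>
  obtain c' where c': "c' 0 = \<one>\<^bsub>H\<^esub>"
      "\<And>k. 0 < k \<Longrightarrow> k < n \<Longrightarrow> c' k = c' (p k) \<otimes>\<^bsub>H\<^esub> X k [^]\<^bsub>H\<^esub> h k"
    using ex_parent_recursion[of n d p "\<one>\<^bsub>H\<^esub>" "\<lambda>k g. g \<otimes>\<^bsub>H\<^esub> X k [^]\<^bsub>H\<^esub> h k"] p(2) by metis
  have c'_closed: "k < n \<Longrightarrow> c' k \<in> carrier H" for k
  proof (induction k rule: measure_induct_rule[of d])
    case (less k)
    then show ?case using c' p X by (cases "k = 0") (auto simp: K_def)
  qed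
  \<comment> \<open>The value for \<open>i\<close> beyond the rank is a default: the universal
    property asks for an image of every letter.\<close>
  define s' where "s' i = (if i < n then c' i \<otimes>\<^bsub>H\<^esub> T \<otimes>\<^bsub>H\<^esub> inv\<^bsub>H\<^esub> c' i else \<one>\<^bsub>H\<^esub>)" for i
  have s'_closed: "s' i \<in> carrier H" for i using c'_closed T by (simp add: s'_def)
  have s'_sq: "s' i \<otimes>\<^bsub>H\<^esub> s' i = \<one>\<^bsub>H\<^esub>" for i
  proof (cases "i < n")
    case True
    then have "s' i = inv\<^bsub>H\<^esub> (inv\<^bsub>H\<^esub> c' i) \<otimes>\<^bsub>H\<^esub> T \<otimes>\<^bsub>H\<^esub> inv\<^bsub>H\<^esub> c' i"
      using c'_closed by (simp add: s'_def)
    then have "s' i [^]\<^bsub>H\<^esub> (2::nat) = \<one>\<^bsub>H\<^esub>"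
      using True c'_closed[of i] T H.conj_nat_pow[of "inv\<^bsub>H\<^esub> c' i" T 2] by (simp add: numeral_2_eq_2)
    then show ?thesis using s'_closed by (simp add: numeral_2_eq_2)
  qed (simp add: s'_def)
  have X_hh: "X k [^]\<^bsub>H\<^esub> h k \<otimes>\<^bsub>H\<^esub> X k [^]\<^bsub>H\<^esub> h k = X k" if "k \<in> K" for k
    using that X h[of k] by (simp add: H.nat_pow_mult mult_2[symmetric] K_def)
  have s'_edge: "s' k \<otimes>\<^bsub>H\<^esub> s' (p k) = c' (p k) \<otimes>\<^bsub>H\<^esub> X k \<otimes>\<^bsub>H\<^esub> inv\<^bsub>H\<^esub> c' (p k)" if "k \<in> K" for k
  proof -
    have k: "0 < k" "k < n" "p k < n" using that p by (auto simp: K_def)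
    show ?thesis
      using H.twisted_reflection_product[OF T X(1)[OF that] X(3)[OF that] c'_closed[OF k(3)] X_hh[OF that]]
        k c'(2) by (simp add: s'_def)
  qed
  have s'_edge_pow: "(s' k \<otimes>\<^bsub>H\<^esub> s' (p k)) [^]\<^bsub>H\<^esub> l = c' (p k) \<otimes>\<^bsub>H\<^esub> X k [^]\<^bsub>H\<^esub> l \<otimes>\<^bsub>H\<^esub> inv\<^bsub>H\<^esub> c' (p k)"
    if "k \<in> K" for k and l :: nat
    using that p(1) c'_closed[of "p k"] X(1) H.conj_nat_pow[of "inv\<^bsub>H\<^esub> c' (p k)" "X k" l] s'_edge
    by (simp add: K_def)
  have s'_rel: "(s' k \<otimes>\<^bsub>H\<^esub> s' (p k)) [^]\<^bsub>H\<^esub> M k = \<one>\<^bsub>H\<^esub>" if "k \<in> K" for k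
    using that s'_edge_pow[of k "M k"] p(1) c'_closed[of "p k"] X by (simp add: K_def)
  \<comment> \<open>By \<open>tree\<close>, only the diagonal and the parent edges, in both
    orientations, carry a relation.\<close>
  have "(s' i \<otimes>\<^bsub>H\<^esub> s' j) [^]\<^bsub>H\<^esub> k = \<one>\<^bsub>H\<^esub>" if ij: "i < n" "j < n" "m i j = enat k" for i j k
  proof (cases "i = j")
    case True
    then show ?thesis using s'_sq by simp
  next
    case False
    then consider "i \<in> K" "p i = j" | "j \<in> K" "p j = i"
      using tree[OF ij(1,2) False] ij by (auto simp: K_def)
    then show ?thesis
    proof cases
      case 1
      then have "k = M i" using M(2)[of i] ij by (simp add: K_def)
      then show ?thesis using s'_rel 1 by blast
    next
      case 2
      then have "k = M j" using M(1)[of j] ij by (simp add: K_def)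
      \<comment> \<open>Reversing an edge inverts the rotation.\<close>
      moreover have "s' i \<otimes>\<^bsub>H\<^esub> s' j = inv\<^bsub>H\<^esub> (s' j \<otimes>\<^bsub>H\<^esub> s' i)"
        using s'_closed H.inv_equality[OF s'_sq s'_closed s'_closed] by (simp add: H.inv_mult_group)
      ultimately show ?thesis using s'_rel[of j] 2 s'_closed by (simp add: H.nat_pow_inv)
    qed
  qed
  then have "letter_prod H s' l = letter_prod H s' r" if "(l, r) \<in> coxeter_rels n m" for l r
    using that s'_closed by (auto simp: coxeter_rels_def H.letter_prod_cox_relator)
  then obtain \<phi> where \<phi>: "\<phi> \<in> hom ?G H" "\<And>i. i < n \<Longrightarrow> \<phi> (s i) = s' i"
    using H.presented_group_hom_exists[of s' "coxeter_rels n m" n] s'_closed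
    unfolding coxeter_group_def s_def by metis
  interpret \<phi>: group_hom ?G H \<phi> using \<phi>(1) by unfold_locales
  have \<phi>_c: "k < n \<Longrightarrow> \<phi> (c k) = c' k" for k
  proof (induction k rule: measure_induct_rule[of d])
    case (less k)
    show ?case
    proof (cases "k = 0")
      case False
      then have k: "0 < k" "k \<in> K" "p k < n" "d (p k) < d k" using less.prems p by (auto simp: K_def)
      have "\<phi> (c k) = (s' k \<otimes>\<^bsub>H\<^esub> s' (p k)) [^]\<^bsub>H\<^esub> h k \<otimes>\<^bsub>H\<^esub> c' (p k)"
        using c(2)[OF k(1) less.prems] less s tw(1) k \<phi>(2) by (simp add: \<phi>.hom_nat_pow)
      also have "\<dots> = c' k"
        using k c'_closed[OF k(3)] X(1)[OF k(2)] c'(2)[OF k(1) less.prems]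
        by (simp add: s'_edge_pow H.m_assoc)
      finally show ?thesis .
    qed (simp add: c c')
  qed
  have \<phi>_x: "\<phi> (x k) = X k" if "k \<in> K" for k
  proof -
    have k: "k < n" "p k < n" "s k \<in> carrier ?G" "s (p k) \<in> carrier ?G" "c (p k) \<in> carrier ?G"
      using that p s tw(1) by (auto simp: K_def)
    then have "\<phi> (x k) = inv\<^bsub>H\<^esub> c' (p k) \<otimes>\<^bsub>H\<^esub> (s' k \<otimes>\<^bsub>H\<^esub> s' (p k)) \<otimes>\<^bsub>H\<^esub> c' (p k)"
      using \<phi>_c \<phi>(2) by (simp add: x_def)
    also have "\<dots> = X k"
      using that c'_closed[OF k(2)] X(1) by (simp add: s'_edge H.m_assoc) (simp add: H.m_assoc[symmetric])
    finally show ?thesis .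
  qed
  have \<phi>_t: "\<phi> (s 0) = T" using n \<phi>(2)[OF n] c'(1) T by (simp add: s'_def)
  have \<phi>_prod: "syl_prod ?G x w \<in> carrier ?G \<and> \<phi> (syl_prod ?G x w) = syl_prod H X w"
    if "reduced K M w" for w
    using that by (induction w) (auto simp: reduced_Cons x_closed \<phi>_x \<phi>.hom_nat_pow)

  \<comment> \<open>Equal products in \<open>W\<close> have equal images in \<open>H\<close>, where
    \<open>N\<close> reads off the word and the presence of \<open>T\<close>.\<close>
  interpret inverted_free_product ?G "s 0" x K M
  proof unfold_locales
    show "finite K" by (simp add: K_def)
    show "generate ?G (insert (s 0) (x ` K)) = carrier ?G"
    proof
      show "generate ?G (insert (s 0) (x ` K)) \<subseteq> carrier ?G"
        using n s x_closed by (intro G.generate_incl) auto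
      then show "carrier ?G \<subseteq> generate ?G (insert (s 0) (x ` K))"
        using tw(5) gens(4) G.generate_subgroup_incl[OF _ G.generate_is_subgroup] n s x_closed
        by (metis K_def G.generate_incl image_subset_iff insert_subset)
    qed
    fix w w' assume w: "reduced K M w" "reduced K M w'"
    show "w = w'" if "syl_prod ?G x w = syl_prod ?G x w'"
      using that \<phi>_prod w N(1) by (metis Pair_inject)
    show "syl_prod ?G x w \<noteq> syl_prod ?G x w' \<otimes>\<^bsub>?G\<^esub> s 0"
    proof
      assume "syl_prod ?G x w = syl_prod ?G x w' \<otimes>\<^bsub>?G\<^esub> s 0"
      then have "syl_prod H X w = syl_prod H X w' \<otimes>\<^bsub>H\<^esub> T"
        using \<phi>_prod w \<phi>_t \<phi>.hom_mult s(1)[OF n] by metis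
      then show False using N w by (metis Pair_inject)
    qed
  qed (use M n s tw in \<open>auto simp: K_def\<close>)
  show ?thesis by (rule is_co_hopfian)
qed

section \<open>Rooting a tree\<close>

text \<open>A subtree containing 0 grows one vertex at a time. Connectedness supplies a new
  neighbour, and acyclicity makes its attaching vertex unique.\<close>

lemma cox_tree_parent_exists:
  assumes tree: "cox_tree n m" and cm: "coxeter_matrix n m" and n: "n > 0"
  obtains p d :: "nat \<Rightarrow> nat" where
    "\<And>k. 0 < k \<Longrightarrow> k < n \<Longrightarrow> cox_adj n m (p k) k \<and> d (p k) < d k"
    "\<And>i j. cox_adj n m i j \<Longrightarrow> 0 < i \<and> p i = j \<or> 0 < j \<and> p j = i"
proof -
  let ?adj = "cox_adj n m"
  have "m i j = m j i" if "i < n" "j < n" for i j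
    using cm that unfolding coxeter_matrix_def by blast
  then have sym: "?adj i j \<Longrightarrow> ?adj j i" for i j unfolding cox_adj_def by metis
  \<comment> \<open>Simple paths inside \<open>A\<close>, kept in the invariant in order to close a
    cycle below.\<close>
  define joined where "joined A \<longleftrightarrow> (\<forall>a\<in>A. \<forall>b\<in>A. \<exists>vs. vs \<noteq> [] \<and> hd vs = a \<and> last vs = b \<and>
      distinct vs \<and> set vs \<subseteq> A \<and> successively ?adj vs)" for A
  define parent where "parent A p d \<longleftrightarrow>
      (\<forall>k\<in>A. 0 < k \<longrightarrow> p k \<in> A \<and> ?adj (p k) k \<and> d (p k) < d k) \<and>
      (\<forall>i\<in>A. \<forall>j\<in>A. ?adj i j \<longrightarrow> 0 < i \<and> p i = j \<or> 0 < j \<and> p j = i)" for A and p d :: "nat \<Rightarrow> nat"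
  have "\<exists>A p d. 0 \<in> A \<and> A \<subseteq> {..<n} \<and> card A = Suc l \<and> joined A \<and> parent A p d" if "l < n" for l
    using that
  proof (induction l)
    case 0
    have "joined {0}" unfolding joined_def by (auto intro!: exI[of _ "[0]"])
    moreover have "parent {0} id id" by (simp add: parent_def cox_adj_def)
    ultimately show ?case using n by (intro exI[of _ "{0}"]) auto
  next
    case (Suc l)
    then obtain A p d where A: "0 \<in> A" "A \<subseteq> {..<n}" "card A = Suc l" "joined A" "parent A p d"
      by auto
    have "\<not> {..<n} \<subseteq> A" using A Suc.prems card_mono[of A "{..<n}"] finite_subset[OF A(2)] by auto
    then obtain y where y: "y < n" "y \<notin> A" by auto
    have "?adj\<^sup>*\<^sup>* 0 y" using tree y n by (simp add: cox_tree_def cox_connected_def)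
    \<comment> \<open>A walk from 0 to a vertex outside \<open>A\<close> crosses an edge that leaves
      \<open>A\<close>.\<close>
    then have "\<exists>a z. a \<in> A \<and> z \<notin> A \<and> ?adj a z" using A(1) y(2)
    proof (induction rule: rtranclp_induct)
      case (step v w)
      then show ?case by (cases "v \<in> A") auto
    qed simp
    then obtain a z where az: "a \<in> A" "z \<notin> A" "?adj a z" by blast
    \<comment> \<open>A second neighbour \<open>b\<close> of \<open>z\<close> would close a path
      from \<open>a\<close> to \<open>b\<close> inside \<open>A\<close> to a cycle through
      \<open>z\<close>, of length at least 3.\<close>
    have unique: "b = a" if b: "b \<in> A" "?adj b z" for b
    proof (rule ccontr)
      assume "b \<noteq> a"
      obtain vs where vs: "vs \<noteq> []" "hd vs = a" "last vs = b" "distinct vs" "set vs \<subseteq> A"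
          "successively ?adj vs"
        using A(4) az(1) b(1) unfolding joined_def by blast
      have "length vs \<ge> 2" using vs \<open>b \<noteq> a\<close> by (cases vs; cases "tl vs") auto
      moreover have "successively ?adj (vs @ [z])"
        using vs b by (simp add: successively_append_iff)
      moreover have "distinct (vs @ [z])" using vs az by auto
      ultimately have "length (vs @ [z]) \<ge> 3 \<and> distinct (vs @ [z]) \<and>
          (\<forall>i. Suc i < length (vs @ [z]) \<longrightarrow> ?adj ((vs @ [z]) ! i) ((vs @ [z]) ! Suc i)) \<and>
          ?adj (last (vs @ [z])) (hd (vs @ [z]))"
        using sym[OF az(3)] vs(1,2) by (auto simp: successively_conv_nth)
      then show False using tree unfolding cox_tree_def cox_acyclic_def by blast
    qed
    have to_z: "\<exists>vs. vs \<noteq> [] \<and> hd vs = b \<and> last vs = z \<and> distinct vs \<and> set vs \<subseteq> insert z A \<and>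
        successively ?adj vs" if b: "b \<in> A" for b
    proof -
      obtain vs where vs: "vs \<noteq> []" "hd vs = b" "last vs = a" "distinct vs" "set vs \<subseteq> A"
          "successively ?adj vs"
        using A(4) az(1) b unfolding joined_def by blast
      then show ?thesis using az
        by (intro exI[of _ "vs @ [z]"]) (auto simp: successively_append_iff)
    qed
    have from_z: "\<exists>vs. vs \<noteq> [] \<and> hd vs = z \<and> last vs = b \<and> distinct vs \<and> set vs \<subseteq> insert z A \<and>
        successively ?adj vs" if b: "b \<in> A" for b
    proof -
      obtain vs where "vs \<noteq> []" "hd vs = b" "last vs = z" "distinct vs" "set vs \<subseteq> insert z A"
          "successively ?adj vs"
        using to_z[OF b] by blast
      moreover from this have "successively (\<lambda>x y. ?adj y x) vs"
        using sym by (auto intro: successively_mono)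
      ultimately show ?thesis
        by (intro exI[of _ "rev vs"]) (simp add: hd_rev last_rev)
    qed
    have "joined (insert z A)"
      unfolding joined_def
    proof (intro ballI)
      fix b b' assume bb: "b \<in> insert z A" "b' \<in> insert z A"
      consider "b = z" "b' = z" | "b = z" "b' \<in> A" | "b \<in> A" "b' = z" | "b \<in> A" "b' \<in> A"
        using bb by blast
      then show "\<exists>vs. vs \<noteq> [] \<and> hd vs = b \<and> last vs = b' \<and> distinct vs \<and> set vs \<subseteq> insert z A \<and>
          successively ?adj vs"
      proof cases
        case 1
        then show ?thesis by (intro exI[of _ "[z]"]) auto
      next
        case 4
        then show ?thesis using A(4) unfolding joined_def by (meson subset_insertI2)
      qed (use to_z from_z in auto)
    qed
    moreover have "parent (insert z A) (p(z := a)) (d(z := Suc (d a)))"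
    proof -
      let ?p = "p(z := a)" and ?d = "d(z := Suc (d a))"
      have z: "0 < z" using A(1) az(2) by (metis gr0I)
      have 1: "?p k \<in> insert z A \<and> ?adj (?p k) k \<and> ?d (?p k) < ?d k"
        if k: "k \<in> insert z A" "0 < k" for k
      proof (cases "k = z")
        case False
        then have "p k \<in> A" "?adj (p k) k" "d (p k) < d k" using k A(5) by (auto simp: parent_def)
        moreover from this have "p k \<noteq> z" using az(2) by metis
        ultimately show ?thesis using False by simp
      qed (use az in auto)
      have 2: "0 < i \<and> ?p i = j \<or> 0 < j \<and> ?p j = i"
        if ij: "i \<in> insert z A" "j \<in> insert z A" "?adj i j" for i j
      proof -
        consider "i = z" "j = z" | "i = z" "j \<in> A" | "i \<in> A" "j = z" | "i \<in> A" "j \<in> A"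
          using ij by blast
        then show ?thesis
        proof cases
          case 1
          then show ?thesis using ij by (simp add: cox_adj_def)
        next
          case 2
          then have "j = a" using unique sym[OF ij(3)] by blast
          then show ?thesis using 2 z by simp
        next
          case 3
          then have "i = a" using unique ij(3) by blast
          then show ?thesis using 3 z by simp
        next
          case 4
          then have "i \<noteq> z" "j \<noteq> z" using az(2) by metis+
          then show ?thesis using A(5) 4 ij(3) by (simp add: parent_def)
        qed
      qed
      show ?thesis unfolding parent_def by (rule conjI; intro ballI impI; rule 1 2; assumption)
    qed
    moreover have "card (insert z A) = Suc (Suc l)"
      using A az finite_subset[OF A(2)] by simp
    moreover have "insert z A \<subseteq> {..<n}" using A az by (auto simp: cox_adj_def)
    ultimately show ?case using A(1) by blast
  qed
  from this[of "n - 1"] obtain A p d where A: "A \<subseteq> {..<n}" "card A = n" "parent A p d"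
    using n by auto
  from A(1,2) have "A = {..<n}" by (simp add: card_subset_eq)
  then show ?thesis using A(3) that[of p d] unfolding parent_def by (auto simp: cox_adj_def)
qed

text \<open>Conjugation by the isomorphism turns injective endomorphisms of \<open>W\<close> into
  injective endomorphisms of \<open>G\<close>, and surjectivity comes back the same way.\<close>

lemma co_hopfian_if_iso:
  assumes "group W" "W \<cong> G" "co_hopfian G"
  shows "co_hopfian W"
  unfolding co_hopfian_def
proof (intro ballI impI)
  interpret W: group W by fact
  fix f assume f: "f \<in> hom W W" "inj_on f (carrier W)"
  obtain g where g: "g \<in> iso W G" using assms(2) by (auto simp: is_iso_def)
  let ?h = "inv_into (carrier W) g"
  have h: "?h \<in> iso G W" using W.iso_set_sym[OF g] .
  have gb: "bij_betw g (carrier W) (carrier G)" and hb: "bij_betw ?h (carrier G) (carrier W)"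
    using g h by (auto simp: iso_def)
  have "g \<circ> (f \<circ> ?h) \<in> hom G G"
    using f g h by (intro Group.hom_compose[of _ G W]) (auto simp: iso_def intro: Group.hom_compose)
  moreover have "inj_on (g \<circ> (f \<circ> ?h)) (carrier G)"
  proof (intro comp_inj_on)
    show "inj_on ?h (carrier G)" using hb by (simp add: bij_betw_def)
    show "inj_on f (?h ` carrier G)" using f(2) hb by (simp add: bij_betw_def)
    have "(f \<circ> ?h) ` carrier G \<subseteq> carrier W"
      using f(1) hb by (auto simp: bij_betw_def hom_def)
    then show "inj_on g ((f \<circ> ?h) ` carrier G)"
      using gb by (auto simp: bij_betw_def intro: inj_on_subset)
  qed
  ultimately have "bij_betw (g \<circ> (f \<circ> ?h)) (carrier G) (carrier G)"
    using assms(3) by (auto simp: co_hopfian_def iso_def)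
  then have "(g \<circ> (f \<circ> ?h)) ` carrier G = g ` carrier W"
    using gb by (simp add: bij_betw_def)
  then have "g ` (f ` carrier W) = g ` carrier W"
    using hb by (simp only: bij_betw_def image_comp[symmetric])
  then have "f ` carrier W = carrier W"
    using gb f(1) inj_on_image_eq_iff[of g "carrier W" "f ` carrier W" "carrier W"]
    by (auto simp: bij_betw_def hom_def)
  then show "f \<in> iso W W" using f by (simp add: iso_def bij_betw_def)
qed

section \<open>The groups \<open>L_m\<close> as Coxeter groups of paths\<close>

text \<open>Braid relations between neighbours amount to exponent 3. Distant generators are
  unrelated, so their exponent is infinite rather than 2 as in the symmetric group.\<close>

definition path_matrix :: "nat \<Rightarrow> nat \<Rightarrow> enat" where
  "path_matrix i j = (if i = j then 1 else if i = Suc j \<or> j = Suc i then 3 else \<infinity>)"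

lemma pres_eq_mono:
  assumes "pres_eq R u v" "\<And>l r. (l, r) \<in> R \<Longrightarrow> pres_eq R' l r"
  shows "pres_eq R' u v"
  using assms(1) by induction (auto intro: pres_eq.intros pres_eq_append_context assms(2))

text \<open>The word \<open>[j, i, j]\<close> is its own inverse when both letters are involutions,
  so it can be moved across the equation.\<close>

lemma pres_eq_braid_iff:
  assumes ii: "pres_eq R [i, i] []" and jj: "pres_eq R [j, j] []"
  shows "pres_eq R [i, j, i, j, i, j] [] \<longleftrightarrow> pres_eq R [i, j, i] [j, i, j]"
proof
  have cancel: "pres_eq R [j, i, j, j, i, j] []"
  proof -
    have "pres_eq R ([j, i] @ [j, j] @ [i, j]) ([j, i] @ [] @ [i, j])"
      using jj by (rule pres_eq_append_context)
    moreover have "pres_eq R ([j] @ [i, i] @ [j]) ([j] @ [] @ [j])"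
      using ii by (rule pres_eq_append_context)
    ultimately show ?thesis using jj by (auto intro: pres_eq.pres_trans)
  qed
  {
    assume "pres_eq R [i, j, i] [j, i, j]"
    then have "pres_eq R ([] @ [i, j, i] @ [j, i, j]) ([] @ [j, i, j] @ [j, i, j])"
      by (rule pres_eq_append_context)
    then show "pres_eq R [i, j, i, j, i, j] []" using cancel by (auto intro: pres_eq.pres_trans)
  next
    assume *: "pres_eq R [i, j, i, j, i, j] []"
    have "pres_eq R ([i, j, i] @ []) ([i, j, i] @ [j, i, j, j, i, j])"
      using cancel by (intro pres_eq_append pres_eq.pres_refl pres_eq.pres_sym[OF cancel])
    moreover have "pres_eq R ([] @ [i, j, i, j, i, j] @ [j, i, j]) ([] @ [] @ [j, i, j])"
      using * by (rule pres_eq_append_context)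
    ultimately show "pres_eq R [i, j, i] [j, i, j]" by (auto intro: pres_eq.pres_trans)
  }
qed

text \<open>Each set of relations follows from the other, so the two congruences coincide and the
  groups are equal, not merely isomorphic.\<close>

lemma pres_eq_L_rels: "pres_eq (L_rels k) = pres_eq (coxeter_rels (k - 1) path_matrix)"
proof -
  let ?L = "L_rels k" and ?C = "coxeter_rels (k - 1) path_matrix"
  have base: "pres_eq R l r" if "(l, r) \<in> R" for R l r
    using pres_eq.pres_rel[OF that, of "[]" "[]"] by simp
  have L: "pres_eq ?L [i, i] []" if "i < k - 1" for i
    using that by (intro base) (auto simp: L_rels_def)
  have C: "pres_eq ?C (cox_relator i j l) []" if "i < k - 1" "j < k - 1" "path_matrix i j = enat l"
    for i j l using that by (intro base) (auto simp: coxeter_rels_def)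
  have C1: "pres_eq ?C [i, i] []" if "i < k - 1" for i
    using C[of i i 1] that by (simp add: path_matrix_def cox_relator_def one_enat_def)
  have three: "cox_relator i j 3 = [i, j, i, j, i, j]" for i j
    by (simp add: cox_relator_def numeral_3_eq_3)
  have "pres_eq ?C l r" if lr: "(l, r) \<in> ?L" for l r
  proof -
    consider i where "i < k - 1" "l = [i, i]" "r = []"
      | i where "Suc i < k - 1" "l = [i, Suc i, i]" "r = [Suc i, i, Suc i]"
      using lr by (auto simp: L_rels_def)
    then show ?thesis
    proof cases
      case (2 i)
      then have "pres_eq ?C [i, Suc i, i, Suc i, i, Suc i] []"
        using C[of i "Suc i" 3] by (simp add: path_matrix_def three numeral_eq_enat)
      then show ?thesis using 2 C1[of i] C1[of "Suc i"] pres_eq_braid_iff by simp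
    qed (use C1 in simp)
  qed
  moreover have "pres_eq ?L l r" if "(l, r) \<in> ?C" for l r
  proof -
    obtain i j e where ij: "i < k - 1" "j < k - 1" "path_matrix i j = enat e"
        "l = cox_relator i j e" "r = []"
      using \<open>(l, r) \<in> ?C\<close> by (auto simp: coxeter_rels_def)
    have braid: "pres_eq ?L [i, Suc i, i] [Suc i, i, Suc i]" if "Suc i < k - 1" for i
      using that by (intro base) (auto simp: L_rels_def)
    consider "i = j" "e = 1" | "i = Suc j" "e = 3" | "j = Suc i" "e = 3"
      using ij(3) by (auto simp: path_matrix_def one_enat_def numeral_eq_enat split: if_splits)
    then show ?thesis
    proof cases
      case 1
      then show ?thesis using ij L by (simp add: cox_relator_def)
    next
      case 2
      then have "pres_eq ?L [i, j, i] [j, i, j]" using braid[of j] ij pres_eq.pres_sym by blast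
      then show ?thesis using pres_eq_braid_iff[OF L[OF ij(1)] L[OF ij(2)]] 2(2) ij by (simp add: three)
    next
      case 3
      then have "pres_eq ?L [i, j, i] [j, i, j]" using braid[of i] ij by blast
      then show ?thesis using pres_eq_braid_iff[OF L[OF ij(1)] L[OF ij(2)]] 3(2) ij by (simp add: three)
    qed
  qed
  ultimately show ?thesis by (intro ext iffI) (blast intro: pres_eq_mono)+
qed

lemma L_group_eq_coxeter_group: "L_group k = coxeter_group (k - 1) path_matrix"
  by (simp add: L_group_def coxeter_group_def presented_group_def pres_rel_set_def pres_eq_L_rels)

text \<open>The path is rooted at 0 with parent \<open>i - 1\<close> and depth \<open>i\<close>. For
  \<open>k = 2\<close> the rank is 1, which \<open>co_hopfian_coxeter_group\<close> allows.\<close>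

lemma co_hopfian_L_group:
  assumes "k \<ge> 2"
  shows "co_hopfian (L_group k)"
  unfolding L_group_eq_coxeter_group
proof (rule co_hopfian_coxeter_group[where p = "\<lambda>i. i - 1" and d = id])
  show "coxeter_matrix (k - 1) path_matrix"
    by (auto simp: coxeter_matrix_def path_matrix_def)
  have "\<exists>l. (3::enat) = enat l \<and> odd l"
    by (rule exI[of _ 3]) (simp add: numeral_eq_enat)
  then show "odd_coxeter (k - 1) path_matrix"
    by (simp add: odd_coxeter_def path_matrix_def)
  have "\<exists>l. enat l = 3" by (rule exI[of _ 3]) (simp add: numeral_eq_enat)
  then show "path_matrix (i - 1) i \<noteq> \<infinity>" if "0 < i" for i
    using that by (auto simp: path_matrix_def)
qed (use assms in \<open>auto simp: path_matrix_def split: if_splits\<close>)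

theorem theorem5p8:
  fixes W :: "('a, 'b) monoid_scheme"
  shows "(group W \<and>
          (\<exists>n m. n \<ge> 2 \<and> coxeter_matrix n m \<and> odd_coxeter n m \<and>
                 cox_connected n m \<and> cox_tree n m \<and> W \<cong> coxeter_group n m)
          \<longrightarrow> co_hopfian W)
         \<and> (\<forall>k::nat. k \<ge> 2 \<longrightarrow> co_hopfian (L_group k))"
proof (intro conjI impI allI)
  assume "group W \<and> (\<exists>n m. n \<ge> 2 \<and> coxeter_matrix n m \<and> odd_coxeter n m \<and>
      cox_connected n m \<and> cox_tree n m \<and> W \<cong> coxeter_group n m)"
  then obtain n m where "group W" and n: "n \<ge> 2" and cm: "coxeter_matrix n m"
      and odd: "odd_coxeter n m" and tree: "cox_tree n m" and iso: "W \<cong> coxeter_group n m"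
    by blast
  have "n > 0" using n by simp
  then obtain p d where pd: "\<And>k. 0 < k \<Longrightarrow> k < n \<Longrightarrow> cox_adj n m (p k) k \<and> d (p k) < (d k :: nat)"
      "\<And>i j. cox_adj n m i j \<Longrightarrow> 0 < i \<and> p i = j \<or> 0 < j \<and> p j = i"
    by (rule cox_tree_parent_exists[OF tree cm]) (rule that; assumption)
  have "co_hopfian (coxeter_group n m)"
    using \<open>n > 0\<close> cm odd pd
    by (intro co_hopfian_coxeter_group[where p = p and d = d]) (auto simp: cox_adj_def)
  then show "co_hopfian W" using co_hopfian_if_iso \<open>group W\<close> iso by blast
next
  fix k :: nat assume "k \<ge> 2"
  then show "co_hopfian (L_group k)" by (rule co_hopfian_L_group)
qed

end
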